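(* Let $p$ and $q$ be monic polynomials with degree $2$ over $\mathbb{F}$, and assume that they are both irreducible with distinct splitting fields (in $\overline{\mathbb{F}}$), that they are separable and that $\operatorname{tr}p=\operatorname{tr}q=0$. Set $r:=t^2-p(0)q(0)^{-1}$. Let $u$ be an endomorphism of a finite-dimensional vector space $V$ over $\mathbb{F}$. Then, the following conditions are equivalent: (i) The endomorphism $u$ is a q-exceptional $(p,q)$-quotient. (ii) The minimal polynomial of $u$ is a power of $r$, and if we denote by $r_1,\dots,r_k,\dots$ the invariant factors of $u$, then $r_{2k-1}=r_{2k}$ for all $k\geq 1$. (iii) In some basis of $V$, the endomorphism $u$ is represented by a block-diagonal matrix in which each diagonal block equals $C(r^n)\oplus C(r^n)$ for some positive integer $n$.
   Context: $\mathbb{F}$ is an arbitrary field with algebraic closure $\overline{\mathbb{F}}$. For a monic polynomial $p$ of degree $n\ge 1$, $\operatorname{tr}(p)$ is the opposite of the coefficient of $p$ on $t^{n-1}$, and $\operatorname{Root}(p)$ is its set of roots in $\overline{\mathbb{F}}$. An endomorphism $u$ of $V$ is a $(p,q)$-quotient if $u=ab^{-1}$ for some automorphisms $a,b$ of $V$ with $p(a)=0$ and $q(b)=0$. It is q-exceptional with respect to $(p,q)$ if all its eigenvalues in $\overline{\mathbb{F}}$ belong to $\operatorname{Root}(p)\operatorname{Root}(q)^{-1}=\{xy^{-1}: x\in\operatorname{Root}(p),\,y\in\operatorname{Root}(q)\}$; a q-exceptional $(p,q)$-quotient is a $(p,q)$-quotient that is q-exceptional with respect to $(p,q)$. $C(r)$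 is the companion matrix of the monic polynomial $r$, and $\oplus$ is block-diagonal sum. The invariant factors of $u$ are the monic polynomials $r_1,r_2,\dots$ with $r_{i+1}\mid r_i$ such that $u$ is represented in some basis by $C(r_1)\oplus C(r_2)\oplus\cdots$ ($C(1)$ being the $0\times 0$ matrix); the finite list of nonconstant ones is extended to an infinite sequence by $r_i=1$. *)

theory Defs
  imports
    "HOL-Algebra.Algebraic_Closure_Type"
    "HOL-Algebra.Generated_Fields"
    "HOL-Computational_Algebra.Polynomial"
    "Jordan_Normal_Form.Char_Poly"
begin

definition poly_tr :: "'a::field poly \<Rightarrow> 'a" where
  "poly_tr p = - Polynomial.coeff p (Polynomial.degree p - 1)"

definition Root :: "'a::field poly \<Rightarrow> 'a alg_closure set" where
  "Root p = {x. poly (map_poly to_ac p) x = 0}"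

definition separable_poly :: "'a::field poly \<Rightarrow> bool" where
  "separable_poly p \<longleftrightarrow> rsquarefree (map_poly to_ac p)"

definition splitting_field :: "'a::field poly \<Rightarrow> 'a alg_closure set" where
  "splitting_field p = generate_field ring_of_type_algebra (range to_ac \<union> Root p)"

text \<open>Below, the vector space is a whole type \<open>'v\<close> with scalar multiplication \<open>scale\<close>, as in
  the locale \<^locale>\<open>finite_dimensional_vector_space\<close>.\<close>

definition automorphism :: "('a::field \<Rightarrow> 'v::ab_group_add \<Rightarrow> 'v) \<Rightarrow> ('v \<Rightarrow> 'v) \<Rightarrow> bool" where
  "automorphism scale a \<longleftrightarrow> Vector_Spaces.linear scale scale a \<and> bij a"

definition poly_endo ::
  "('a::field \<Rightarrow> 'v::ab_group_add \<Rightarrow> 'v) \<Rightarrow> 'a poly \<Rightarrow> ('v \<Rightarrow> 'v) \<Rightarrow> 'v \<Rightarrow> 'v" where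
  "poly_endo scale p u v =
     (\<Sum>i\<le>Polynomial.degree p. scale (Polynomial.coeff p i) ((u ^^ i) v))"

definition annihilates ::
  "('a::field \<Rightarrow> 'v::ab_group_add \<Rightarrow> 'v) \<Rightarrow> 'a poly \<Rightarrow> ('v \<Rightarrow> 'v) \<Rightarrow> bool" where
  "annihilates scale p u \<longleftrightarrow> (\<forall>v. poly_endo scale p u v = 0)"

definition pq_quotient ::
  "('a::field \<Rightarrow> 'v::ab_group_add \<Rightarrow> 'v) \<Rightarrow> 'a poly \<Rightarrow> 'a poly \<Rightarrow> ('v \<Rightarrow> 'v) \<Rightarrow> bool" where
  "pq_quotient scale p q u \<longleftrightarrow>
     (\<exists>a b. automorphism scale a \<and> automorphism scale b \<and>
            annihilates scale p a \<and> annihilates scale q b \<and> u = a \<circ> inv_into UNIV b)"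

definition ordered_basis :: "('a::field \<Rightarrow> 'v::ab_group_add \<Rightarrow> 'v) \<Rightarrow> 'v list \<Rightarrow> bool" where
  "ordered_basis scale bs \<longleftrightarrow>
     distinct bs \<and> \<not> module.dependent scale (set bs) \<and> module.span scale (set bs) = UNIV"

text \<open>Column convention: column \<open>j\<close> of \<open>A\<close> holds the coordinates of \<open>u (bs ! j)\<close>.\<close>

definition represented_by ::
  "('a::field \<Rightarrow> 'v::ab_group_add \<Rightarrow> 'v) \<Rightarrow> ('v \<Rightarrow> 'v) \<Rightarrow> 'v list \<Rightarrow> 'a mat \<Rightarrow> bool" where
  "represented_by scale u bs A \<longleftrightarrow>
     ordered_basis scale bs \<and> A \<in> carrier_mat (length bs) (length bs) \<and>
     (\<forall>j<length bs. u (bs ! j) = (\<Sum>i<length bs. scale (A $$ (i, j)) (bs ! i)))"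

text \<open>Eigenvalues in the algebraic closure are those of the extension of scalars of \<open>u\<close>, that is,
  of any matrix representing \<open>u\<close>, viewed over the closure.\<close>

definition closure_eigenvalue ::
  "('a::field \<Rightarrow> 'v::ab_group_add \<Rightarrow> 'v) \<Rightarrow> ('v \<Rightarrow> 'v) \<Rightarrow> 'a alg_closure \<Rightarrow> bool" where
  "closure_eigenvalue scale u z \<longleftrightarrow>
     (\<exists>bs A. represented_by scale u bs A \<and> eigenvalue (map_mat to_ac A) z)"

definition q_exceptional ::
  "('a::field \<Rightarrow> 'v::ab_group_add \<Rightarrow> 'v) \<Rightarrow> 'a poly \<Rightarrow> 'a poly \<Rightarrow> ('v \<Rightarrow> 'v) \<Rightarrow> bool" where
  "q_exceptional scale p q u \<longleftrightarrow>
     (\<forall>z. closure_eigenvalue scale u z \<longrightarrow> z \<in> {x * inverse y | x y. x \<in> Root p \<and> y \<in> Root q})"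

definition is_min_poly ::
  "('a::field \<Rightarrow> 'v::ab_group_add \<Rightarrow> 'v) \<Rightarrow> ('v \<Rightarrow> 'v) \<Rightarrow> 'a poly \<Rightarrow> bool" where
  "is_min_poly scale u m \<longleftrightarrow>
     lead_coeff m = 1 \<and> annihilates scale m u \<and> (\<forall>f. annihilates scale f u \<longrightarrow> m dvd f)"

definition companion_mat :: "'a::field poly \<Rightarrow> 'a mat" where
  "companion_mat r = (let n = Polynomial.degree r in
     mat n n (\<lambda>(i, j). if j = n - 1 then - Polynomial.coeff r i
                       else if i = Suc j then 1 else 0))"

text \<open>The sequence is indexed from 1; the value \<open>rs 0\<close> is irrelevant.\<close>

definition is_invariant_factors ::
  "('a::field \<Rightarrow> 'v::ab_group_add \<Rightarrow> 'v) \<Rightarrow> ('v \<Rightarrow> 'v) \<Rightarrow> (nat \<Rightarrow> 'a poly) \<Rightarrow> bool" where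
  "is_invariant_factors scale u rs \<longleftrightarrow>
     (\<forall>i\<ge>1. lead_coeff (rs i) = 1 \<and> rs (i + 1) dvd rs i) \<and>
     (\<exists>N. (\<forall>i>N. rs i = 1) \<and>
          (\<exists>bs. represented_by scale u bs
                 (diag_block_mat (map (\<lambda>i. companion_mat (rs i)) [1..<N + 1]))))"

end

theory Submission
  imports Defs
begin

text \<open>Write \<open>p = X\<^sup>2 - P\<close>, \<open>q = X\<^sup>2 - Q\<close> and \<open>\<delta> = P / Q\<close>, so that \<open>r = X\<^sup>2 - \<delta>\<close>. Putting \<open>a = u b\<close>, the
  endomorphism \<open>u\<close> is a \<open>(p, q)\<close>-quotient iff some \<open>b\<close> satisfies \<open>b\<^sup>2 = Q\<close> and \<open>u b u = \<delta> b\<close>, and it is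
  q-exceptional iff \<open>r(u)\<close> is nilpotent. In that case every \<open>f(u) + g(u) b\<close> with \<open>f\<close>, \<open>g\<close> not both
  divisible by \<open>r\<close> is invertible, because \<open>Q\<close> is not a square in the field of polynomials modulo \<open>r\<close>
  (the fields generated by the roots of \<open>p\<close> and \<open>q\<close> differ). Hence the algebra generated by \<open>u\<close> and
  \<open>b\<close> acts like an Artinian uniserial ring: \<open>V\<close> is a direct sum of cyclic modules, and the one generated by \<open>v\<close>
  is the direct sum of the \<open>u\<close>-cyclic spaces of \<open>v\<close> and \<open>b v\<close>, both with annihilator \<open>r\<^sup>n\<close>.
  Conversely, on a sum of two \<open>u\<close>-cyclic spaces with generators \<open>v\<close>, \<open>w\<close> and annihilator \<open>r\<^sup>n\<close> one takes
  \<open>b (f(u) v) = f(\<delta> u\<^sup>-\<^sup>1) w\<close> and \<open>b (f(u) w) = Q f(\<delta> u\<^sup>-\<^sup>1) v\<close>.\<close>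

section \<open>The module structure given by an endomorphism, and companion blocks\<close>

locale endomorphism = vector_space scale
  for scale :: "'a::field \<Rightarrow> 'v::ab_group_add \<Rightarrow> 'v" +
  fixes u :: "'v \<Rightarrow> 'v"
  assumes linear_u: "Vector_Spaces.linear scale scale u"
begin

sublocale vector_space_pair scale scale ..

abbreviation act :: "'a poly \<Rightarrow> 'v \<Rightarrow> 'v" where
  "act f \<equiv> poly_endo scale f u"

lemma linear_funpow: "Vector_Spaces.linear scale scale (u ^^ i)"
proof (induction i)
  case 0
  show ?case using linear_id by (simp add: id_def)
next
  case (Suc i)
  show ?case
    using Vector_Spaces.linear_compose[OF Suc linear_u] by (simp add: o_def)
qed

text \<open>Letting the sum run up to any bound above the degree brings polynomials of different
  degrees under a common range of summation.\<close>

lemma act_bound: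
  assumes "Polynomial.degree f \<le> n"
  shows "act f v = (\<Sum>i\<le>n. scale (Polynomial.coeff f i) ((u ^^ i) v))"
  unfolding poly_endo_def using assms
  by (intro sum.mono_neutral_left) (auto simp: coeff_eq_0 not_le)

lemma linear_act: "Vector_Spaces.linear scale scale (act f)"
proof -
  have "Vector_Spaces.linear scale scale
    (\<lambda>v. \<Sum>i\<le>Polynomial.degree f. scale (Polynomial.coeff f i) ((u ^^ i) v))"
    by (intro linear_compose_sum ballI linear_compose_scale_right) (simp add: linear_funpow)
  then show ?thesis
    by (simp add: poly_endo_def[abs_def])
qed

lemmas act_linear_simps =
  linear_0[OF linear_act] linear_add[OF linear_act] linear_scale[OF linear_act]
  linear_neg[OF linear_act] linear_diff[OF linear_act]

lemma act_0 [simp]: "act 0 v = 0"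
  by (simp add: poly_endo_def)

lemma act_add: "act (f + g) v = act f v + act g v"
proof -
  let ?n = "max (Polynomial.degree f) (Polynomial.degree g)"
  have "act (f + g) v = (\<Sum>i\<le>?n. scale (Polynomial.coeff (f + g) i) ((u ^^ i) v))"
    by (rule act_bound) (simp add: degree_add_le)
  then show ?thesis
    by (simp add: act_bound[of f ?n] act_bound[of g ?n] scale_left_distrib sum.distrib)
qed

lemma act_smult: "act (smult c f) v = scale c (act f v)"
  by (simp add: act_bound[of "smult c f" "Polynomial.degree f"] degree_smult_le
      act_bound[of f "Polynomial.degree f"] scale_sum_right)

lemma act_minus: "act (- f) v = - act f v"
  using act_smult[of "-1" f v] by simp

lemma act_diff: "act (f - g) v = act f v - act g v"
  using act_add[of f "- g" v] by (simp add: act_minus)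

lemma act_pCons: "act (pCons c f) v = scale c v + u (act f v)"
proof -
  let ?n = "Polynomial.degree f"
  have "act (pCons c f) v = (\<Sum>i\<le>Suc ?n. scale (Polynomial.coeff (pCons c f) i) ((u ^^ i) v))"
    by (rule act_bound) (simp add: degree_pCons_le)
  also have "\<dots> = scale c v + (\<Sum>i\<le>?n. scale (Polynomial.coeff f i) (u ((u ^^ i) v)))"
    by (simp add: sum.atMost_Suc_shift del: sum.atMost_Suc)
  also have "(\<Sum>i\<le>?n. scale (Polynomial.coeff f i) (u ((u ^^ i) v))) = u (act f v)"
    by (simp add: act_bound[of f ?n] linear_sum[OF linear_u] linear_scale[OF linear_u])
  finally show ?thesis .
qed

lemma act_1 [simp]: "act 1 v = v"
  by (simp add: one_pCons act_pCons linear_0[OF linear_u])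

lemma act_const [simp]: "act [:c:] v = scale c v"
  by (simp add: act_pCons linear_0[OF linear_u])

lemma act_X [simp]: "act [:0, 1:] v = u v"
  by (simp add: act_pCons linear_0[OF linear_u])

lemma act_mult: "act (f * g) v = act f (act g v)"
  by (induction f arbitrary: v) (simp_all add: act_pCons act_add act_smult)

lemma act_commute: "act f (act g v) = act g (act f v)"
  by (metis act_mult mult.commute)

lemma act_u: "act f (u v) = u (act f v)"
  using act_commute[of f "[:0, 1:]"] by simp

lemma act_sum: "act (\<Sum>i\<in>A. f i) v = (\<Sum>i\<in>A. act (f i) v)"
  by (induction A rule: infinite_finite_induct) (simp_all add: act_add)

lemma act_dvd:
  assumes "act f v = 0" "f dvd g"
  shows "act g v = 0"
  using assms by (metis dvd_def act_mult mult.commute linear_0[OF linear_act])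

lemma act_X_power: "act ([:0, 1:] ^ i) v = (u ^^ i) v"
  by (induction i) (simp_all add: act_mult del: mult_pCons_left)

lemma act_monom: "act (Polynomial.monom c i) v = scale c ((u ^^ i) v)"
  by (simp add: monom_altdef act_smult act_X_power)

lemma act_power_le:
  assumes "act (f ^ m) v = 0" "m \<le> n"
  shows "act (f ^ n) v = 0"
  using act_dvd[OF assms(1)] assms(2) by (simp add: le_imp_power_dvd)

lemma sum_scale_funpow:
  "(\<Sum>i<d. scale (c i) ((u ^^ i) v)) = act (\<Sum>i<d. Polynomial.monom (c i) i) v"
  by (simp add: act_sum act_monom)

end

section \<open>Matrix relations split over diagonal blocks, and companion blocks as orbits\<close>

definition acts_by_mat ::
  "('a::field \<Rightarrow> 'v::ab_group_add \<Rightarrow> 'v) \<Rightarrow> ('v \<Rightarrow> 'v) \<Rightarrow> 'v list \<Rightarrow> 'a mat \<Rightarrow> bool" where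
  "acts_by_mat scale u bs A \<longleftrightarrow>
     A \<in> carrier_mat (length bs) (length bs) \<and>
     (\<forall>j<length bs. u (bs ! j) = (\<Sum>i<length bs. scale (A $$ (i, j)) (bs ! i)))"

text \<open>Separating the basis condition leaves a system of equations that makes sense for any
  list of vectors and can be split block by block.\<close>

lemma represented_by_iff:
  "represented_by scale u bs A \<longleftrightarrow> ordered_basis scale bs \<and> acts_by_mat scale u bs A"
  by (simp add: represented_by_def acts_by_mat_def)

lemma sum_lessThan_add:
  fixes f :: "nat \<Rightarrow> 'b::comm_monoid_add"
  shows "(\<Sum>i<n + m. f i) = (\<Sum>i<n. f i) + (\<Sum>i<m. f (n + i))"
  by (induction m) (simp_all add: add.assoc)

text \<open>The zero blocks remove the other half of the list from every column, so each half
  satisfies its own equations.\<close>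

lemma (in vector_space) acts_by_mat_append:
  assumes "A \<in> carrier_mat (length xs) (length xs)" "B \<in> carrier_mat (length ys) (length ys)"
  shows "acts_by_mat scale u (xs @ ys)
           (four_block_mat A (0\<^sub>m (length xs) (length ys)) (0\<^sub>m (length ys) (length xs)) B) \<longleftrightarrow>
         acts_by_mat scale u xs A \<and> acts_by_mat scale u ys B" (is "acts_by_mat _ _ _ ?M \<longleftrightarrow> _")
proof -
  have left: "(\<Sum>i<length (xs @ ys). scale (?M $$ (i, j)) ((xs @ ys) ! i)) =
      (\<Sum>i<length xs. scale (A $$ (i, j)) (xs ! i))" if "j < length xs" for j
    using assms that by (simp add: sum_lessThan_add nth_append)
  have right: "(\<Sum>i<length (xs @ ys). scale (?M $$ (i, length xs + j)) ((xs @ ys) ! i)) =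
      (\<Sum>i<length ys. scale (B $$ (i, j)) (ys ! i))" if "j < length ys" for j
    using assms that by (simp add: sum_lessThan_add nth_append)
  have split: "(\<forall>j<length (xs @ ys). P j) \<longleftrightarrow>
      (\<forall>j<length xs. P j) \<and> (\<forall>j<length ys. P (length xs + j))" for P
    by (auto simp: all_conj_distrib) (metis add_diff_inverse_nat nat_add_left_cancel_less)
  show ?thesis
    unfolding acts_by_mat_def split using assms left right by (auto simp: nth_append)
qed

definition orbit :: "('v \<Rightarrow> 'v) \<Rightarrow> 'v \<Rightarrow> nat \<Rightarrow> 'v list" where
  "orbit u v d = map (\<lambda>i. (u ^^ i) v) [0..<d]"

lemma length_orbit [simp]: "length (orbit u v d) = d"
  by (simp add: orbit_def)

lemma nth_orbit [simp]: "i < d \<Longrightarrow> orbit u v d ! i = (u ^^ i) v"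
  by (simp add: orbit_def)

lemma companion_mat_carrier [simp]:
  "companion_mat f \<in> carrier_mat (Polynomial.degree f) (Polynomial.degree f)"
  by (simp add: companion_mat_def Let_def)

lemma dim_companion_mat [simp]:
  "dim_row (companion_mat f) = Polynomial.degree f" "dim_col (companion_mat f) = Polynomial.degree f"
  by (simp_all add: companion_mat_def Let_def)

context endomorphism
begin

text \<open>The subdiagonal ones make every vector the image of its predecessor under
  \<open>u\<close>; the last column then says that \<open>f(u)\<close> kills the first vector.
  Independence of the list plays no part in this dictionary.\<close>

lemma acts_by_companion_mat_iff:
  assumes monic: "lead_coeff f = 1"
  shows "acts_by_mat scale u bs (companion_mat f) \<longleftrightarrow>
           (\<exists>v. bs = orbit u v (Polynomial.degree f) \<and> act f v = 0)"
proof (cases "Polynomial.degree f")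
  case 0
  then have "f = 1"
    using monic by (metis degree_eq_zeroE lead_coeff_pCons(2) one_pCons)
  \<comment> \<open>Here \<open>f(u) v = 0\<close> means \<open>v = 0\<close>, so the zero vector
    serves as generator of the empty list.\<close>
  then show ?thesis
    by (auto simp: acts_by_mat_def orbit_def companion_mat_def)
next
  case (Suc d)
  let ?C = "companion_mat f"
  have shift: "(\<Sum>i<Suc d. scale (?C $$ (i, j)) (bs ! i)) = bs ! Suc j"
    if "j < d" for j and bs :: "'v list"
  proof -
    have "(\<Sum>i<Suc d. scale (?C $$ (i, j)) (bs ! i)) = (\<Sum>i<Suc d. if i = Suc j then bs ! i else 0)"
      using that Suc by (intro sum.cong) (auto simp: companion_mat_def)
    then show ?thesis using that by simp
  qed
  have last: "(\<Sum>i<Suc d. scale (?C $$ (i, d)) (bs ! i)) =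
      - (\<Sum>i<Suc d. scale (Polynomial.coeff f i) (bs ! i))" for bs :: "'v list"
    using Suc by (simp add: companion_mat_def sum_negf)
  have act_f: "act f v = (u ^^ Suc d) v + (\<Sum>i<Suc d. scale (Polynomial.coeff f i) ((u ^^ i) v))" for v
    using monic Suc by (simp add: poly_endo_def lessThan_Suc_atMost add.commute)
  show ?thesis
  proof
    assume acts: "acts_by_mat scale u bs ?C"
    then have len: "length bs = Suc d"
      using Suc by (auto simp: acts_by_mat_def)
    define v where "v = bs ! 0"
    have step: "u (bs ! j) = bs ! Suc j" if "j < d" for j
      using acts shift[OF that, of bs] that len by (simp add: acts_by_mat_def)
    have nth: "bs ! j = (u ^^ j) v" if "j \<le> d" for j
      using that by (induction j) (simp_all add: v_def flip: step)
    have "u (bs ! d) = - (\<Sum>i<Suc d. scale (Polynomial.coeff f i) (bs ! i))"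
      using acts last[of bs] len by (simp add: acts_by_mat_def)
    moreover have "(\<Sum>i<Suc d. scale (Polynomial.coeff f i) (bs ! i)) =
        (\<Sum>i<Suc d. scale (Polynomial.coeff f i) ((u ^^ i) v))"
      by (intro sum.cong) (auto simp: nth)
    ultimately have "act f v = 0"
      unfolding act_f by (simp add: nth)
    moreover have "bs = orbit u v (Suc d)"
      using len nth by (intro nth_equalityI) (auto simp: less_Suc_eq_le)
    ultimately show "\<exists>v. bs = orbit u v (Polynomial.degree f) \<and> act f v = 0"
      using Suc by auto
  next
    assume "\<exists>v. bs = orbit u v (Polynomial.degree f) \<and> act f v = 0"
    then obtain v where bs: "bs = orbit u v (Suc d)" and v: "act f v = 0"
      using Suc by auto
    have "u (bs ! j) = (\<Sum>i<Suc d. scale (?C $$ (i, j)) (bs ! i))" if "j < Suc d" for j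
    proof (cases "j < d")
      case True
      then show ?thesis using shift[OF True, of bs] by (simp add: bs)
    next
      case False
      then have "j = d" using that by simp
      moreover have "(\<Sum>i<Suc d. scale (Polynomial.coeff f i) (bs ! i)) =
          (\<Sum>i<Suc d. scale (Polynomial.coeff f i) ((u ^^ i) v))"
        by (intro sum.cong) (auto simp: bs)
      ultimately show ?thesis
        using v last[of bs] that unfolding act_f
        by (simp add: bs eq_neg_iff_add_eq_0 del: sum.lessThan_Suc) (metis add_right_cancel)
    qed
    then show "acts_by_mat scale u bs ?C"
      using companion_mat_carrier[of f] Suc by (simp add: acts_by_mat_def bs del: sum.lessThan_Suc)
  qed
qed

text \<open>A pair \<open>(f, v)\<close> encodes a diagonal block \<open>C(f)\<close> together with
  a generator \<open>v\<close> for it.\<close>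

abbreviation orbits :: "('a poly \<times> 'v) list \<Rightarrow> 'v list" where
  "orbits ps \<equiv> concat (map (\<lambda>(f, v). orbit u v (Polynomial.degree f)) ps)"

text \<open>Peeling off one block at a time turns the matrix equations into a choice of one
  generator per block. Conditions (ii) and (iii) are both read through this dictionary.\<close>

lemma acts_by_diag_companion_mat_iff:
  assumes "\<forall>f\<in>set fs. lead_coeff f = 1"
  shows "acts_by_mat scale u bs (diag_block_mat (map companion_mat fs)) \<longleftrightarrow>
           (\<exists>ps. map fst ps = fs \<and> bs = orbits ps \<and> (\<forall>(f, v)\<in>set ps. act f v = 0))"
  using assms
proof (induction fs arbitrary: bs)
  case Nil
  then show ?case by (auto simp: acts_by_mat_def)
next
  case (Cons f fs)
  let ?d = "Polynomial.degree f" and ?B = "diag_block_mat (map companion_mat fs)"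
  let ?m = "sum_list (map Polynomial.degree fs)"
  have dims: "dim_row ?B = ?m" "dim_col ?B = ?m"
    by (simp_all add: dim_diag_block_mat o_def)
  then have B: "?B \<in> carrier_mat ?m ?m" by auto
  have M: "diag_block_mat (map companion_mat (f # fs)) =
      four_block_mat (companion_mat f) (0\<^sub>m ?d ?m) (0\<^sub>m ?m ?d) ?B" (is "?M = _")
    by (simp add: Let_def dims)
  have split: "acts_by_mat scale u bs ?M \<longleftrightarrow>
      (\<exists>xs ys. bs = xs @ ys \<and> acts_by_mat scale u xs (companion_mat f) \<and> acts_by_mat scale u ys ?B)"
    (is "_ \<longleftrightarrow> ?R")
  proof
    assume acts: "acts_by_mat scale u bs ?M"
    then have "length bs = ?d + ?m"
      unfolding acts_by_mat_def M using B by (auto simp: dims)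
    then have "length (take ?d bs) = ?d" "length (drop ?d bs) = ?m" by auto
    with acts_by_mat_append[of "companion_mat f" "take ?d bs" ?B "drop ?d bs" u] acts B
    show ?R
      unfolding M by (intro exI[of _ "take ?d bs"] exI[of _ "drop ?d bs"]) simp
  next
    assume ?R
    then obtain xs ys where bs: "bs = xs @ ys"
      and xs: "acts_by_mat scale u xs (companion_mat f)" and ys: "acts_by_mat scale u ys ?B"
      by blast
    then have "length xs = ?d" "length ys = ?m"
      using B by (auto simp: acts_by_mat_def)
    with acts_by_mat_append[of "companion_mat f" xs ?B ys u] xs ys B
    show "acts_by_mat scale u bs ?M"
      unfolding M bs by simp
  qed
  have "lead_coeff f = 1" "\<forall>f\<in>set fs. lead_coeff f = 1"
    using Cons.prems by auto
  note IH = Cons.IH[OF this(2)] and f = acts_by_companion_mat_iff[OF this(1)]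
  show ?case
    unfolding split f IH
    by (fastforce simp: map_eq_Cons_conv Cons_eq_map_conv split: prod.splits)
qed

end

text \<open>Flattens the nested diagonal blocks of condition (iii) into a single list of companion
  matrices.\<close>

lemma diag_block_mat_concat:
  "diag_block_mat (map (\<lambda>x. diag_block_mat (F x)) xs) = diag_block_mat (concat (map F xs))"
  by (induction xs) (simp_all add: Let_def diag_block_mat_append)

section \<open>Ordered bases\<close>

text \<open>Bases of proper subspaces occur when the space is split step by step;
  \<open>ordered_basis\<close> is the case of the whole space.\<close>

definition list_basis ::
  "('a::field \<Rightarrow> 'v::ab_group_add \<Rightarrow> 'v) \<Rightarrow> 'v set \<Rightarrow> 'v list \<Rightarrow> bool" where
  "list_basis scale S bs \<longleftrightarrow>
     distinct bs \<and> \<not> module.dependent scale (set bs) \<and> module.span scale (set bs) = S"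

context vector_space
begin

lemma ordered_basis_iff: "ordered_basis scale bs \<longleftrightarrow> list_basis scale UNIV bs"
  by (simp add: ordered_basis_def list_basis_def)

lemma sum_list_coeffs:
  assumes "distinct bs"
  shows "(\<Sum>i<length bs. scale (c (bs ! i)) (bs ! i)) = (\<Sum>x\<in>set bs. scale (c x) x)"
  using bij_betw_nth[OF assms refl refl] by (rule sum.reindex_bij_betw)

text \<open>With coefficients indexed by positions, a repeated vector is itself a linear relation,
  so distinctness and independence merge into one condition.\<close>

lemma distinct_independent_iff:
  "distinct bs \<and> independent (set bs) \<longleftrightarrow>
     (\<forall>c. (\<Sum>i<length bs. scale (c i) (bs ! i)) = 0 \<longrightarrow> (\<forall>i<length bs. c i = 0))"
  (is "?L \<longleftrightarrow> ?R")
proof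
  assume L: ?L
  show ?R
  proof (intro allI impI)
    fix c i
    assume c: "(\<Sum>i<length bs. scale (c i) (bs ! i)) = 0" and i: "i < length bs"
    \<comment> \<open>Coefficients are carried from positions to vectors; distinctness makes this
      well defined.\<close>
    define g where "g x = c (inv_into {..<length bs} ((!) bs) x)" for x
    have g: "g (bs ! j) = c j" if "j < length bs" for j
      using that L by (simp add: g_def inv_into_f_f inj_on_nth)
    have "(\<Sum>x\<in>set bs. scale (g x) x) = (\<Sum>i<length bs. scale (g (bs ! i)) (bs ! i))"
      using L by (simp add: sum_list_coeffs)
    also have "\<dots> = 0"
      using c by (simp add: g)
    finally have "g (bs ! i) = 0"
      using L i by (auto intro: independentD[of "set bs" "set bs" g])
    then show "c i = 0" using g i by simp
  qed
next
  assume R: ?R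
  have dist: "distinct bs"
    unfolding distinct_conv_nth
  proof (intro allI impI notI)
    fix i j
    assume ij: "i < length bs" "j < length bs" "i \<noteq> j" and eq: "bs ! i = bs ! j"
    \<comment> \<open>The relation \<open>bs ! i - bs ! j = 0\<close> that a repetition would
      give.\<close>
    let ?c = "\<lambda>k. (if k = i then 1 else 0) - (if k = j then 1 else 0 :: 'a)"
    have "scale (?c k) (bs ! k) = (if k = i then bs ! k else 0) - (if k = j then bs ! k else 0)" for k
      by (simp add: scale_left_diff_distrib)
    then have "(\<Sum>k<length bs. scale (?c k) (bs ! k)) = 0"
      using ij eq by (simp add: sum_subtractf)
    then have "?c i = 0" using ij(1) by (rule R[rule_format, of ?c])
    with ij show False by simp
  qed
  moreover have "independent (set bs)"
    unfolding dependent_finite[OF finite_set]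
  proof
    assume "\<exists>g. (\<exists>x\<in>set bs. g x \<noteq> 0) \<and> (\<Sum>x\<in>set bs. scale (g x) x) = 0"
    then obtain g x where g: "x \<in> set bs" "g x \<noteq> 0" "(\<Sum>x\<in>set bs. scale (g x) x) = 0"
      by blast
    from g(3) have "(\<Sum>i<length bs. scale (g (bs ! i)) (bs ! i)) = 0"
      by (simp add: sum_list_coeffs[OF dist])
    then have "g (bs ! i) = 0" if "i < length bs" for i
      using that by (rule R[rule_format, of "\<lambda>i. g (bs ! i)"])
    with g(1,2) show False by (auto simp: in_set_conv_nth)
  qed
  ultimately show ?L ..
qed

lemma list_basisD:
  assumes "list_basis scale S bs" "(\<Sum>i<length bs. scale (c i) (bs ! i)) = 0" "i < length bs"
  shows "c i = 0"
proof -
  have "\<forall>c. (\<Sum>i<length bs. scale (c i) (bs ! i)) = 0 \<longrightarrow> (\<forall>i<length bs. c i = 0)"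
    using assms(1) unfolding list_basis_def distinct_independent_iff[symmetric] by simp
  then show ?thesis using assms(2,3) by blast
qed

lemma span_set_list: "span (set bs) = range (\<lambda>c. \<Sum>i<length bs. scale (c i) (bs ! i))"
proof (intro equalityI subsetI)
  fix x assume "x \<in> span (set bs)"
  then show "x \<in> range (\<lambda>c. \<Sum>i<length bs. scale (c i) (bs ! i))"
  proof (induction rule: span_induct_alt)
    case base
    show ?case by (intro image_eqI[of _ _ "\<lambda>_. 0"]) simp_all
  next
    case (step a x y)
    then obtain c j where j: "j < length bs" "x = bs ! j"
      and y: "y = (\<Sum>i<length bs. scale (c i) (bs ! i))"
      by (auto simp: in_set_conv_nth)
    have "scale (c i + (if i = j then a else 0)) (bs ! i) =
        scale (c i) (bs ! i) + (if i = j then scale a (bs ! i) else 0)" for i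
      by (simp add: scale_left_distrib)
    then have "scale a x + y = (\<Sum>i<length bs. scale (c i + (if i = j then a else 0)) (bs ! i))"
      using j y by (simp add: sum.distrib)
    then show ?case by (rule range_eqI[where x = "\<lambda>i. c i + (if i = j then a else 0)"])
  qed
next
  fix x assume "x \<in> range (\<lambda>c. \<Sum>i<length bs. scale (c i) (bs ! i))"
  then show "x \<in> span (set bs)"
    by (auto intro!: span_sum span_scale[OF span_base[OF nth_mem]])
qed

text \<open>In a relation on \<open>xs @ ys\<close> the part on \<open>xs\<close> is minus the part
  on \<open>ys\<close>, hence lies in both subspaces and vanishes.\<close>

lemma list_basis_append:
  assumes xs: "list_basis scale M xs" and ys: "list_basis scale N ys" and int: "M \<inter> N \<subseteq> {0}"
  shows "list_basis scale {x + y | x y. x \<in> M \<and> y \<in> N} (xs @ ys)"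
proof -
  have M: "M = span (set xs)" and N: "N = span (set ys)"
    using xs ys by (simp_all add: list_basis_def)
  have "\<forall>i<length (xs @ ys). c i = 0"
    if c: "(\<Sum>i<length (xs @ ys). scale (c i) ((xs @ ys) ! i)) = 0" for c
  proof -
    let ?x = "\<Sum>i<length xs. scale (c i) (xs ! i)"
    let ?y = "\<Sum>i<length ys. scale (c (length xs + i)) (ys ! i)"
    have "(\<Sum>i<length xs. scale (c i) ((xs @ ys) ! i)) = ?x"
      by (intro sum.cong) (auto simp: nth_append)
    then have sum: "?x + ?y = 0"
      using c by (simp add: sum_lessThan_add nth_append)
    have x: "?x \<in> M" unfolding M span_set_list by blast
    have y: "?y \<in> N" unfolding N span_set_list by (rule range_eqI) (rule refl)
    have "?x = - ?y" using sum by (simp add: eq_neg_iff_add_eq_0)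
    then have "?x \<in> N" using y N by (metis span_neg)
    with x int have "?x = 0" by blast
    with sum have "?y = 0" by simp
    show ?thesis
    proof (intro allI impI)
      fix i assume i: "i < length (xs @ ys)"
      show "c i = 0"
      proof (cases "i < length xs")
        case True
        then show ?thesis using list_basisD[OF xs \<open>?x = 0\<close>] by blast
      next
        case False
        then have "i - length xs < length ys" using i by auto
        then have "c (length xs + (i - length xs)) = 0"
          by (rule list_basisD[OF ys \<open>?y = 0\<close>])
        then show ?thesis using False by simp
      qed
    qed
  qed
  then have "distinct (xs @ ys) \<and> independent (set (xs @ ys))"
    unfolding distinct_independent_iff by blast
  moreover have "span (set (xs @ ys)) = {x + y | x y. x \<in> M \<and> y \<in> N}"
    unfolding M N by (simp add: span_Un)
  ultimately show ?thesis by (simp add: list_basis_def)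
qed

text \<open>Serves to isolate the orbit of a single generator inside a basis made of orbits.\<close>

lemma list_basis_subset:
  assumes "list_basis scale S (concat xss)" "xs \<in> set xss"
  shows "list_basis scale (span (set xs)) xs"
  using assms independent_mono[of "set (concat xss)" "set xs"] unfolding list_basis_def
  by (auto simp: distinct_concat_iff)

end

lemma (in vector_space_pair) linear_extend_list:
  assumes "list_basis s1 S bs"
  obtains g where "Vector_Spaces.linear s1 s2 g" "\<And>i. i < length bs \<Longrightarrow> g (bs ! i) = y i"
proof -
  have bs: "distinct bs" "vs1.independent (set bs)"
    using assms by (simp_all add: list_basis_def)
  let ?f = "\<lambda>x. y (inv_into {..<length bs} ((!) bs) x)"
  obtain g where "Vector_Spaces.linear s1 s2 g" "\<forall>x\<in>set bs. g x = ?f x"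
    using linear_independent_extend[OF bs(2), of ?f] by blast
  moreover have "?f (bs ! i) = y i" if "i < length bs" for i
    using that bs(1) by (simp add: inv_into_f_f inj_on_nth)
  ultimately show ?thesis using that by auto
qed

section \<open>Cyclic subspaces, annihilators and eigenvalues\<close>

context endomorphism
begin

lemma act_of_coeffs:
  assumes "Polynomial.degree g < d"
  shows "act g v = (\<Sum>i<d. scale (Polynomial.coeff g i) (orbit u v d ! i))"
  using assms by (cases d) (simp_all add: act_bound[of g] lessThan_Suc_atMost)

lemma act_mod:
  assumes "act f v = 0"
  shows "act (g mod f) v = act g v"
proof -
  have "act g v = act (g div f * f + g mod f) v" by (simp only: div_mult_mod_eq)
  also have "\<dots> = act (g mod f) v"
    by (simp only: act_add act_mult assms linear_0[OF linear_act] add_0)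
  finally show ?thesis by simp
qed

text \<open>Division by \<open>f\<close> reduces every polynomial in \<open>u\<close> applied to
  \<open>v\<close> to one of degree below that of \<open>f\<close>.\<close>

lemma span_orbit:
  assumes "f \<noteq> 0" "act f v = 0"
  shows "span (set (orbit u v (Polynomial.degree f))) = range (\<lambda>g. act g v)"
proof -
  let ?d = "Polynomial.degree f"
  show ?thesis
  proof (intro equalityI subsetI)
    fix x assume "x \<in> span (set (orbit u v ?d))"
    then obtain c where "x = (\<Sum>i<?d. scale (c i) ((u ^^ i) v))"
      unfolding span_set_list by auto
    then show "x \<in> range (\<lambda>g. act g v)"
      by (auto simp: sum_scale_funpow)
  next
    fix x assume "x \<in> range (\<lambda>g. act g v)"
    then obtain g where "x = act g v" by blast
    then have x: "x = act (g mod f) v" using assms by (simp add: act_mod)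
    show "x \<in> span (set (orbit u v ?d))"
    proof (cases "g mod f = 0")
      case True
      then show ?thesis using x by (simp add: span_zero)
    next
      case False
      then have deg: "Polynomial.degree (g mod f) < ?d"
        using degree_mod_less[OF assms(1), of g] by simp
      show ?thesis
        unfolding x act_of_coeffs[OF deg]
        by (intro span_sum span_scale[OF span_base[OF nth_mem]]) simp
    qed
  qed
qed

text \<open>A relation on the orbit is a polynomial of degree below that of \<open>f\<close> killing
  \<open>v\<close>; being a multiple of \<open>f\<close>, it is zero.\<close>

lemma list_basis_orbit:
  assumes "f \<noteq> 0" "act f v = 0" and min: "\<And>g. act g v = 0 \<Longrightarrow> f dvd g"
  shows "list_basis scale (range (\<lambda>g. act g v)) (orbit u v (Polynomial.degree f))"
proof -
  let ?d = "Polynomial.degree f"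
  have "\<forall>i<?d. c i = 0" if c: "(\<Sum>i<?d. scale (c i) (orbit u v ?d ! i)) = 0" for c
  proof -
    let ?g = "\<Sum>i<?d. Polynomial.monom (c i) i"
    have "act ?g v = 0"
      using c by (simp add: act_sum act_monom)
    then have "f dvd ?g" by (rule min)
    have coeff: "Polynomial.coeff ?g i = (if i < ?d then c i else 0)" for i
      by (simp add: coeff_sum)
    have "?g = 0"
    proof (rule ccontr)
      assume "?g \<noteq> 0"
      then have "?d \<le> Polynomial.degree ?g"
        using \<open>f dvd ?g\<close> by (rule dvd_imp_degree_le[rotated])
      with coeff[of "Polynomial.degree ?g"] \<open>?g \<noteq> 0\<close> show False by simp
    qed
    with coeff show ?thesis by (metis Polynomial.coeff_0)
  qed
  then show ?thesis
    using distinct_independent_iff[of "orbit u v ?d"] span_orbit[OF assms(1,2)]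
    by (simp add: list_basis_def)
qed

text \<open>Converse of the previous fact: a nonzero remainder of \<open>g\<close> modulo
  \<open>f\<close> would be a relation on the independent orbit.\<close>

lemma orbit_annihilator_dvd:
  assumes "f \<noteq> 0" "act f v = 0" "list_basis scale S (orbit u v (Polynomial.degree f))" "act g v = 0"
  shows "f dvd g"
proof (rule ccontr)
  let ?d = "Polynomial.degree f"
  assume "\<not> f dvd g"
  then have ne: "g mod f \<noteq> 0" by (simp add: dvd_eq_mod_eq_0)
  then have deg: "Polynomial.degree (g mod f) < ?d"
    using degree_mod_less[OF assms(1), of g] by simp
  have "act (g mod f) v = 0" using assms(2,4) by (simp add: act_mod)
  then have "(\<Sum>i<length (orbit u v ?d).
      scale (Polynomial.coeff (g mod f) i) (orbit u v ?d ! i)) = 0"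
    using act_of_coeffs[OF deg, of v] by simp
  then have "\<forall>i<?d. Polynomial.coeff (g mod f) i = 0"
    using list_basisD[OF assms(3)] by simp
  with deg have "lead_coeff (g mod f) = 0" by blast
  with ne show False by simp
qed

text \<open>Cayley--Hamilton, with \<open>'v\<close> seen as a module over the polynomial ring: the basis is killed by
  the characteristic matrix, hence by its product with its adjugate.\<close>

lemma char_poly_annihilates:
  assumes "represented_by scale u bs A"
  shows "annihilates scale (char_poly A) u"
proof -
  let ?n = "length bs" and ?M = "char_poly_matrix A" and ?N = "adj_mat (char_poly_matrix A)"
  have A: "A \<in> carrier_mat ?n ?n"
    and u: "\<And>j. j < ?n \<Longrightarrow> u (bs ! j) = (\<Sum>i<?n. scale (A $$ (i, j)) (bs ! i))"
    using assms by (auto simp: represented_by_def)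
  have span: "span (set bs) = UNIV"
    using assms by (simp add: represented_by_def ordered_basis_def)
  have M: "?M \<in> carrier_mat ?n ?n" using A by simp
  note adj = adj_mat[OF M]
  \<comment> \<open>Column \<open>j\<close> of the characteristic matrix, applied to the basis, is
    \<open>u (bs ! j)\<close> minus its expansion by \<open>A\<close>.\<close>
  have col: "(\<Sum>i<?n. act (?M $$ (i, j)) (bs ! i)) = 0" if j: "j < ?n" for j
  proof -
    have "act (?M $$ (i, j)) (bs ! i) = (if i = j then u (bs ! i) else 0) - scale (A $$ (i, j)) (bs ! i)"
      if "i < ?n" for i
      using A that j act_X
      by (simp add: char_poly_matrix_def act_add act_pCons linear_0[OF linear_u])
    then have "(\<Sum>i<?n. act (?M $$ (i, j)) (bs ! i)) =
        (\<Sum>i<?n. (if i = j then u (bs ! i) else 0) - scale (A $$ (i, j)) (bs ! i))"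
      by (intro sum.cong) auto
    then show ?thesis using u[OF j] j by (simp add: sum_subtractf)
  qed
  have "act (char_poly A) (bs ! k) = 0" if k: "k < ?n" for k
  proof -
    have "act (char_poly A) (bs ! k) = (\<Sum>i<?n. act ((?M * ?N) $$ (i, k)) (bs ! i))"
    proof -
      have "act ((?M * ?N) $$ (i, k)) (bs ! i) = (if i = k then act (char_poly A) (bs ! i) else 0)"
        if "i < ?n" for i
        using that k by (simp add: adj(2) char_poly_def)
      then have "(\<Sum>i<?n. act ((?M * ?N) $$ (i, k)) (bs ! i)) =
          (\<Sum>i<?n. if i = k then act (char_poly A) (bs ! i) else 0)"
        by (intro sum.cong) auto
      then show ?thesis using k by simp
    qed
    also have "\<dots> = (\<Sum>i<?n. \<Sum>j<?n. act (?N $$ (j, k)) (act (?M $$ (i, j)) (bs ! i)))"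
    proof (intro sum.cong refl)
      fix i assume "i \<in> {..<?n}"
      then have "(?M * ?N) $$ (i, k) = (\<Sum>j<?n. ?M $$ (i, j) * ?N $$ (j, k))"
        using M adj(1) k by (auto simp: scalar_prod_def lessThan_atLeast0 intro!: sum.cong)
      then show "act ((?M * ?N) $$ (i, k)) (bs ! i) =
          (\<Sum>j<?n. act (?N $$ (j, k)) (act (?M $$ (i, j)) (bs ! i)))"
        by (simp add: act_sum act_mult act_commute[of "?M $$ (i, _)"])
    qed
    also have "\<dots> = (\<Sum>j<?n. act (?N $$ (j, k)) (\<Sum>i<?n. act (?M $$ (i, j)) (bs ! i)))"
      by (subst sum.swap) (simp add: linear_sum[OF linear_act])
    also have "\<dots> = 0"
      by (simp add: col linear_0[OF linear_act])
    finally show ?thesis .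
  qed
  then have "\<And>x. x \<in> set bs \<Longrightarrow> act (char_poly A) x = 0"
    by (auto simp: in_set_conv_nth)
  then show ?thesis
    unfolding annihilates_def using linear_eq_0_on_span[OF linear_act] span by blast
qed

text \<open>An eigenvector of the transpose of \<open>A\<close> is the list of values on the basis
  of a nonzero linear map \<open>\<phi>\<close> from the space to the closure with
  \<open>\<phi> (u w) = z * \<phi> w\<close>. Then \<open>\<phi>\<close> turns \<open>f(u)\<close>
  into multiplication by \<open>f(z)\<close>, so \<open>f(u) = 0\<close> forces
  \<open>f(z) = 0\<close>.\<close>

lemma eigenvalue_root_of_annihilator:
  assumes f: "annihilates scale f u" and rep: "represented_by scale u bs A"
    and z: "eigenvalue (map_mat to_ac A) z"
  shows "poly (map_poly to_ac f) z = 0"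
proof -
  let ?n = "length bs" and ?A = "map_mat to_ac A"
  \<comment> \<open>The closure regarded as a vector space over the base field, the target of
    \<open>\<phi>\<close>.\<close>
  let ?kscale = "\<lambda>(c::'a) (k::'a alg_closure). to_ac c * k"
  have A: "?A \<in> carrier_mat ?n ?n" and u: "\<And>j. j < ?n \<Longrightarrow> u (bs ! j) = (\<Sum>i<?n. scale (A $$ (i, j)) (bs ! i))"
    using rep by (auto simp: represented_by_def)
  have At: "transpose_mat ?A \<in> carrier_mat ?n ?n" using A by simp
  have "eigenvalue (transpose_mat ?A) z"
    using z eigenvalue_root_char_poly[OF A] eigenvalue_root_char_poly[OF At]
    by (simp add: char_poly_transpose_mat[OF A])
  then obtain x where x: "x \<in> carrier_vec ?n" "x \<noteq> 0\<^sub>v ?n" "transpose_mat ?A *\<^sub>v x = z \<cdot>\<^sub>v x"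
    using At by (auto simp: eigenvalue_def eigenvector_def)
  have xj: "(\<Sum>i<?n. to_ac (A $$ (i, j)) * x $ i) = z * x $ j" if j: "j < ?n" for j
  proof -
    have "(transpose_mat ?A *\<^sub>v x) $ j = (z \<cdot>\<^sub>v x) $ j" using x(3) by simp
    then show ?thesis
      using A x(1) j by (simp add: scalar_prod_def lessThan_atLeast0)
  qed
  interpret K: vector_space ?kscale
    by unfold_locales (simp_all add: algebra_simps)
  interpret P: vector_space_pair scale ?kscale ..
  have lb: "list_basis scale UNIV bs" using rep by (simp add: represented_by_def ordered_basis_iff)
  obtain \<phi> where \<phi>: "Vector_Spaces.linear scale ?kscale \<phi>" "\<And>i. i < ?n \<Longrightarrow> \<phi> (bs ! i) = x $ i"
    using P.linear_extend_list[OF lb, of "\<lambda>i. x $ i"] by blast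
  have span: "span (set bs) = UNIV" using lb by (simp add: list_basis_def)
  have \<phi>u: "\<phi> (u w) = z * \<phi> w" for w
  proof (rule P.linear_eq_on_span[where B = "set bs" and f = "\<lambda>w. \<phi> (u w)" and g = "\<lambda>w. z * \<phi> w"])
    show "Vector_Spaces.linear scale ?kscale (\<lambda>w. \<phi> (u w))"
      using Vector_Spaces.linear_compose[OF linear_u \<phi>(1)] by (simp add: o_def)
    show "Vector_Spaces.linear scale ?kscale (\<lambda>w. z * \<phi> w)"
      unfolding Vector_Spaces.linear_iff using vector_space_axioms K.vector_space_axioms
      by (simp add: P.linear_add[OF \<phi>(1)] P.linear_scale[OF \<phi>(1)] distrib_left mult.left_commute)
    show "w \<in> span (set bs)" using span by simp
    fix y assume "y \<in> set bs"
    then obtain j where j: "j < ?n" "y = bs ! j" by (auto simp: in_set_conv_nth)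
    show "\<phi> (u y) = z * \<phi> y"
      using j xj[OF j(1)] by (simp add: u P.linear_sum[OF \<phi>(1)] P.linear_scale[OF \<phi>(1)] \<phi>(2))
  qed
  have \<phi>act: "\<phi> (act g w) = poly (map_poly to_ac g) z * \<phi> w" for g w
    by (induction g)
      (simp_all add: act_pCons map_poly_pCons P.linear_0[OF \<phi>(1)] P.linear_add[OF \<phi>(1)]
        P.linear_scale[OF \<phi>(1)] \<phi>u algebra_simps)
  obtain i where i: "i < ?n" "x $ i \<noteq> 0"
    using x(1,2) by (metis carrier_vecD eq_vecI index_zero_vec)
  have "poly (map_poly to_ac f) z * \<phi> (bs ! i) = 0"
    using f by (simp add: annihilates_def P.linear_0[OF \<phi>(1)] flip: \<phi>act)
  then show ?thesis using i by (simp add: \<phi>(2))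
qed

lemma ex_represented_by:
  assumes "finite B" "span B = UNIV" "independent B"
  shows "\<exists>bs A. represented_by scale u bs A"
proof -
  obtain bs where bs: "set bs = B" "distinct bs"
    using finite_distinct_list[OF assms(1)] by blast
  let ?n = "length bs"
  have "\<exists>c. \<forall>j. u (bs ! j) = (\<Sum>i<?n. scale (c j i) (bs ! i))"
  proof (rule choice, rule allI)
    fix j
    have "u (bs ! j) \<in> span (set bs)" using assms(2) bs by simp
    then show "\<exists>c. u (bs ! j) = (\<Sum>i<?n. scale (c i) (bs ! i))"
      unfolding span_set_list by auto
  qed
  then obtain c where "\<And>j. u (bs ! j) = (\<Sum>i<?n. scale (c j i) (bs ! i))" by blast
  then have "represented_by scale u bs (mat ?n ?n (\<lambda>(i, j). c j i))"
    using assms bs by (simp add: represented_by_def ordered_basis_def)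
  then show ?thesis by blast
qed

end

section \<open>Coprimality with an irreducible polynomial\<close>

lemma irreducible_poly_bezout:
  fixes r f :: "'a::field poly"
  assumes irr: "Factorial_Ring.irreducible r" and ndvd: "\<not> r dvd f"
  shows "\<exists>s t. s * f + t * r = 1"
proof -
  let ?P = "\<lambda>d. d \<noteq> 0 \<and> (\<exists>s t. d = s * f + t * r)"
  have "?P r"
    using irr by (auto intro: exI[of _ 0] exI[of _ 1])
  \<comment> \<open>A nonzero combination of least degree divides all combinations, since a
    remainder would be a combination of smaller degree.\<close>
  then obtain d where d: "?P d" and min: "\<And>e. ?P e \<Longrightarrow> Polynomial.degree d \<le> Polynomial.degree e"
    using ex_has_least_nat[of ?P r Polynomial.degree] by blast
  then obtain s t where st: "d = s * f + t * r" and "d \<noteq> 0" by blast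
  have dvd: "d dvd a * f + b * r" for a b
  proof (rule ccontr)
    let ?g = "a * f + b * r"
    assume "\<not> d dvd ?g"
    then have "?g mod d \<noteq> 0" by (simp add: dvd_eq_mod_eq_0)
    moreover have "?g mod d = (a - ?g div d * s) * f + (b - ?g div d * t) * r"
    proof -
      have "?g mod d = ?g - ?g div d * d" by (simp add: minus_div_mult_eq_mod)
      also have "?g div d * d = ?g div d * s * f + ?g div d * t * r"
        by (subst (2) st) (simp add: algebra_simps)
      finally show ?thesis by (simp add: algebra_simps)
    qed
    ultimately have "Polynomial.degree d \<le> Polynomial.degree (?g mod d)"
      using min by blast
    with degree_mod_less[OF \<open>d \<noteq> 0\<close>, of ?g] \<open>?g mod d \<noteq> 0\<close> show False by simp
  qed
  have "d dvd f" "d dvd r" using dvd[of 1 0] dvd[of 0 1] by simp_all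
  then have "is_unit d"
    using irr ndvd by (metis dvd_trans irreducibleD')
  then obtain e where "1 = d * e" by (rule dvdE)
  then have "e * s * f + e * t * r = 1"
    by (simp add: st algebra_simps)
  then show ?thesis by blast
qed

text \<open>Factors \<open>r\<close> are stripped from \<open>c\<close> one by one. What is left is
  coprime to \<open>r\<close> and has no root in the closure, because a Bezout relation evaluated at
  a common root reads \<open>0 = 1\<close>; so it is constant.\<close>

lemma dvd_irreducible_power_if_roots:
  fixes r c :: "'a::field poly"
  assumes irr: "Factorial_Ring.irreducible r" and "c \<noteq> 0"
    and roots: "\<And>z. poly (map_poly to_ac c) z = 0 \<Longrightarrow> poly (map_poly to_ac r) z = 0"
  shows "\<exists>k. c dvd r ^ k"
  using assms(2,3)
proof (induction "Polynomial.degree c" arbitrary: c rule: less_induct)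
  case less
  interpret to_ac: map_poly_inj_comm_ring_hom "to_ac :: 'a \<Rightarrow> 'a alg_closure"
    by unfold_locales simp_all
  have r0: "r \<noteq> 0" "\<not> is_unit r" using irr by (auto simp: irreducible_def)
  then have deg_r: "Polynomial.degree r > 0" by (metis is_unit_iff_degree neq0_conv)
  show ?case
  proof (cases "r dvd c")
    case True
    then obtain c' where c': "c = r * c'" by (rule dvdE)
    then have "c' \<noteq> 0" using less.prems by auto
    then have "Polynomial.degree c' < Polynomial.degree c"
      using r0 deg_r by (simp add: c' degree_mult_eq)
    moreover have "poly (map_poly to_ac r) z = 0" if "poly (map_poly to_ac c') z = 0" for z
      using that less.prems(2)[of z] by (simp add: c' to_ac.hom_mult)
    ultimately obtain k where "c' dvd r ^ k"
      using less.hyps[of c'] \<open>c' \<noteq> 0\<close> by blast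
    then have "c dvd r ^ Suc k" by (simp add: c')
    then show ?thesis by blast
  next
    case False
    then obtain s t where st: "s * c + t * r = 1"
      using irreducible_poly_bezout[OF irr] by blast
    have "Polynomial.degree c = 0"
    proof (rule ccontr)
      assume "Polynomial.degree c \<noteq> 0"
      then obtain z where z: "poly (map_poly to_ac c) z = 0"
        using alg_closed_imp_poly_has_root[of "map_poly to_ac c"] by (auto simp: degree_map_poly)
      have "poly (map_poly to_ac (s * c + t * r)) z = 0"
        using z less.prems(2)[OF z] by (simp add: to_ac.hom_add to_ac.hom_mult)
      then show False by (simp add: st)
    qed
    then have "c dvd r ^ 0"
      using less.prems(1) by (simp add: is_unit_iff_degree)
    then show ?thesis by blast
  qed
qed

section \<open>Stable decompositions for a pair \<open>u\<close>, \<open>b\<close> with \<open>u b u = \<delta> b\<close>\<close>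

text \<open>If \<open>a\<close> inverts \<open>f\<close> modulo \<open>r\<close> and
  \<open>s\<close> inverts it modulo \<open>r ^ n\<close>, then \<open>(1 - a f) (1 - s f)\<close>
  is divisible by \<open>r ^ Suc n\<close> and has the form \<open>1 - s' f\<close>.\<close>

lemma irreducible_power_bezout:
  fixes r f :: "'a::field poly"
  assumes "Factorial_Ring.irreducible r" "\<not> r dvd f"
  shows "\<exists>s. r ^ n dvd 1 - s * f"
proof (induction n)
  case (Suc n)
  then obtain s where s: "r ^ n dvd 1 - s * f" by blast
  obtain a t where "a * f + t * r = 1"
    using irreducible_poly_bezout[OF assms] by blast
  then have "1 - a * f = t * r" by (metis add_diff_cancel_left')
  then have "r ^ Suc n dvd (1 - a * f) * (1 - s * f)"
    using s by (simp add: mult_dvd_mono)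
  also have "(1 - a * f) * (1 - s * f) = 1 - (a + s - a * s * f) * f"
    by (simp add: algebra_simps)
  finally show ?case by blast
qed simp

lemma obtain_least_nat:
  fixes n :: nat
  assumes "P n"
  obtains k where "k \<le> n" "P k" "\<forall>j<k. \<not> P j"
  using ex_least_nat_le[of P n, OF assms] that by blast

text \<open>A triple \<open>(n, v, w)\<close> encodes one block of condition (iii): \<open>v\<close>
  and \<open>w\<close> generate its two copies of \<open>C(r^n)\<close>.\<close>

definition (in endomorphism) paired_orbits :: "'a poly \<Rightarrow> (nat \<times> 'v \<times> 'v) list \<Rightarrow> 'v list" where
  "paired_orbits r ts = orbits (concat (map (\<lambda>(n, v, w). [(r ^ n, v), (r ^ n, w)]) ts))"

section \<open>Endomorphisms with \<open>r(u)\<close> nilpotent, and the substitution of \<delta> /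
  X for X\<close>

locale primary_endomorphism = endomorphism scale u
  for scale :: "'a::field \<Rightarrow> 'v::ab_group_add \<Rightarrow> 'v" and u :: "'v \<Rightarrow> 'v" +
  fixes \<delta> :: 'a and r :: "'a poly" and N :: nat
  assumes r_def: "r = [:- \<delta>, 0, 1:]"
    and irreducible_r: "Factorial_Ring.irreducible r"
    and nilpotent: "act (r ^ N) v = 0"
begin

lemma \<delta>_nonzero: "\<delta> \<noteq> 0"
proof
  assume "\<delta> = 0"
  then have "r = [:0, 1:] * [:0, 1:]" by (simp add: r_def)
  from irreducibleD[OF irreducible_r this] show False
    by (simp add: is_unit_iff_degree)
qed

lemma r_nonzero [simp]: "r \<noteq> 0"
  using irreducible_r by (auto simp: irreducible_def)

lemma prime_r: "r dvd f * g \<Longrightarrow> r dvd f \<or> r dvd g"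
  using field_poly_irreducible_imp_prime[OF irreducible_r] by (auto simp: prime_elem_def)

lemma act_r: "act r v = u (u v) - scale \<delta> v"
  by (simp add: r_def act_pCons linear_0[OF linear_u])

text \<open>The exponent \<open>Suc N\<close> is positive even when \<open>N = 0\<close>, so
  congruences modulo \<open>r ^ Suc N\<close> can also be reduced modulo \<open>r\<close>.\<close>

lemma act_dvd_nilpotent:
  assumes "r ^ Suc N dvd f"
  shows "act f v = 0"
  using act_dvd[OF nilpotent dvd_trans[OF le_imp_power_dvd assms]] by simp

lemma invertible_act:
  assumes "\<not> r dvd f"
  shows "\<exists>g. \<forall>v. act g (act f v) = v"
proof -
  obtain g where "r ^ Suc N dvd 1 - g * f"
    using irreducible_power_bezout[OF irreducible_r assms] by blast
  then have "act (1 - g * f) v = 0" for v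
    by (rule act_dvd_nilpotent)
  then have "act g (act f v) = v" for v
    by (simp add: act_diff act_mult)
  then show ?thesis by blast
qed

lemma not_dvd_X: "\<not> r dvd [:0, 1:]"
  by (auto simp: r_def dest: dvd_imp_degree_le)

lemma ex_conj_X: "\<exists>h. r ^ Suc N dvd [:0, 1:] * h - [:\<delta>:]"
proof -
  obtain k where "r ^ Suc N dvd 1 - k * [:0, 1:]"
    using irreducible_power_bezout[OF irreducible_r not_dvd_X] by blast
  then have "r ^ Suc N dvd smult (- \<delta>) (1 - k * [:0, 1:])"
    by (rule dvd_smult)
  also have "smult (- \<delta>) (1 - k * [:0, 1:]) = [:0, 1:] * smult \<delta> k - [:\<delta>:]"
    by (simp add: smult_diff_right one_pCons)
  finally show ?thesis by blast
qed

text \<open>Since \<open>b u b\<^sup>-\<^sup>1 = \<delta> u\<^sup>-\<^sup>1\<close>, conjugation by \<open>b\<close> substitutes for \<open>X\<close> a polynomial that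
  represents \<open>\<delta> X\<^sup>-\<^sup>1\<close> modulo a power of \<open>r\<close> annihilating \<open>u\<close>.\<close>

definition conj_X :: "'a poly" where
  "conj_X = (SOME h. r ^ Suc N dvd [:0, 1:] * h - [:\<delta>:])"

lemma dvd_X_conj_X: "r ^ Suc N dvd [:0, 1:] * conj_X - [:\<delta>:]"
  unfolding conj_X_def by (rule someI_ex[OF ex_conj_X])

text \<open>Modulo \<open>r\<close> the square of \<open>X\<close> is \<delta>, so \<delta> / X is X
  itself.\<close>

lemma dvd_conj_X: "r dvd conj_X - [:0, 1:]"
proof -
  have "r dvd [:0, 1:] * conj_X - [:\<delta>:]"
    using dvd_trans[OF dvd_power[of "Suc N" r] dvd_X_conj_X] by simp
  then have "r dvd ([:0, 1:] * conj_X - [:\<delta>:]) - r" by (rule dvd_diff) simp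
  also have "([:0, 1:] * conj_X - [:\<delta>:]) - r = [:0, 1:] * (conj_X - [:0, 1:])"
    by (simp add: r_def algebra_simps)
  finally show ?thesis using prime_r not_dvd_X by blast
qed

lemma u_conj_X: "u (act conj_X v) = scale \<delta> v"
proof -
  have "act ([:0, 1:] * conj_X - [:\<delta>:]) v = 0"
    by (rule act_dvd_nilpotent[OF dvd_X_conj_X])
  then show ?thesis by (simp add: act_diff act_mult del: mult_pCons_left)
qed

lemma u_inject: "u v = u w \<Longrightarrow> v = w"
proof -
  assume "u v = u w"
  then have "scale \<delta> v = scale \<delta> w"
    by (metis u_conj_X act_u)
  then show "v = w" using \<delta>_nonzero by simp
qed

definition conj :: "'a poly \<Rightarrow> 'a poly" where
  "conj f = pcompose f conj_X"

text \<open>The twist between \<open>u\<close> and \<open>b\<close> thus disappears in the residue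
  field of polynomials modulo \<open>r\<close>.\<close>

lemma dvd_conj_diff: "r dvd conj f - f"
proof (induction f)
  case (pCons a f)
  have "conj (pCons a f) - pCons a f = conj_X * (conj f - f) + (conj_X - [:0, 1:]) * f"
    by (simp add: conj_def pcompose_pCons algebra_simps)
  then show ?case
    using pCons.IH dvd_conj_X by (metis dvd_add dvd_mult dvd_mult2)
qed (simp add: conj_def)

lemma conj_mult: "conj (f * g) = conj f * conj g"
  and conj_diff: "conj (f - g) = conj f - conj g"
  and conj_const: "conj [:c:] = [:c:]"
  and conj_X [simp]: "conj [:0, 1:] = conj_X"
  by (simp_all add: conj_def pcompose_add pcompose_mult pcompose_diff pcompose_pCons)

lemma conj_power: "conj (f ^ n) = conj f ^ n"
  by (induction n) (simp_all add: conj_mult, simp add: conj_def)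

text \<open>As \<open>conj r\<close> is again a multiple of \<open>r\<close>, conjugation passes to
  polynomials modulo \<open>r ^ n\<close>, hence to cyclic spaces killed by
  \<open>r ^ n\<close>.\<close>

lemma dvd_conj_power:
  assumes "r ^ n dvd f"
  shows "r ^ n dvd conj f"
proof -
  have "r dvd (conj r - r) + r" by (rule dvd_add[OF dvd_conj_diff dvd_refl])
  then have "r ^ n dvd conj (r ^ n)" by (simp add: conj_power dvd_power_same)
  moreover have "conj (r ^ n) dvd conj f"
    using assms by (auto simp: conj_mult elim!: dvdE)
  ultimately show ?thesis by (rule dvd_trans)
qed

text \<open>Conjugating the congruence \<open>X * conj_X = \<delta>\<close> shows that
  \<open>conj conj_X\<close> also inverts \<open>conj_X\<close> up to \<delta>, as \<open>u\<close>
  does. Hence conjugation is an involution on polynomials in \<open>u\<close>.\<close>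

lemma act_conj_conj_X: "act (conj conj_X) v = u v"
proof -
  have "r ^ Suc N dvd conj_X * conj conj_X - [:\<delta>:]"
    using dvd_conj_power[OF dvd_X_conj_X] by (simp add: conj_diff conj_mult conj_const del: mult_pCons_left)
  then have "act (conj_X * conj conj_X - [:\<delta>:]) v = 0"
    by (rule act_dvd_nilpotent)
  then have "act conj_X (act (conj conj_X) v) = scale \<delta> v"
    by (simp add: act_diff act_mult)
  then have "u (act conj_X (act (conj conj_X) v)) = u (scale \<delta> v)" by simp
  then show ?thesis
    using \<delta>_nonzero by (simp add: u_conj_X linear_scale[OF linear_u])
qed

lemma act_conj_conj: "act (conj (conj f)) v = act f v"
proof (induction f)
  case (pCons a f)
  have "conj (conj (pCons a f)) = [:a:] + conj conj_X * conj (conj f)"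
    by (simp add: conj_def pcompose_pCons pcompose_add pcompose_mult)
  then show ?case
    using pCons.IH by (simp add: act_add act_mult act_pCons act_conj_conj_X linear_0[OF linear_u])
qed (simp add: conj_def)

end

text \<open>By \<open>anisotropic\<close>, adjoining a square root of \<open>Q\<close> to the
  residue field of \<open>r\<close> gives a field; this is the residue field of the algebra
  generated by \<open>u\<close> and \<open>b\<close>.\<close>

locale twisted_pair = primary_endomorphism scale u \<delta> r N +
    finite_dimensional_vector_space scale Basis
  for scale :: "'a::field \<Rightarrow> 'v::ab_group_add \<Rightarrow> 'v" and u :: "'v \<Rightarrow> 'v"
    and \<delta> :: 'a and r :: "'a poly" and N :: nat and Basis :: "'v set" +
  fixes b :: "'v \<Rightarrow> 'v" and Q :: 'a
  assumes linear_b: "Vector_Spaces.linear scale scale b"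
    and b_b: "b (b v) = scale Q v"
    and u_b_u: "u (b (u v)) = scale \<delta> (b v)"
    and anisotropic: "r dvd f\<^sup>2 - smult Q (g\<^sup>2) \<Longrightarrow> r dvd f \<and> r dvd g"
begin

lemma b_u: "b (u v) = act conj_X (b v)"
  by (rule u_inject) (simp add: u_b_u u_conj_X)

lemma b_act: "b (act f v) = act (conj f) (b v)"
  by (induction f)
    (simp_all add: conj_def pcompose_pCons act_pCons act_add act_mult b_u
      linear_0[OF linear_u] linear_0[OF linear_b] linear_add[OF linear_b] linear_scale[OF linear_b])

text \<open>These are the submodules over the algebra generated by \<open>u\<close> and
  \<open>b\<close>.\<close>

definition stable :: "'v set \<Rightarrow> bool" where
  "stable S \<longleftrightarrow> subspace S \<and> (\<forall>x\<in>S. u x \<in> S \<and> b x \<in> S)"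

lemma stable_subspace: "stable S \<Longrightarrow> subspace S"
  and stable_u: "stable S \<Longrightarrow> x \<in> S \<Longrightarrow> u x \<in> S"
  and stable_b: "stable S \<Longrightarrow> x \<in> S \<Longrightarrow> b x \<in> S"
  by (auto simp: stable_def)

lemma stable_act: "stable S \<Longrightarrow> x \<in> S \<Longrightarrow> act f x \<in> S"
proof (induction f)
  case (pCons c f)
  then show ?case
    unfolding act_pCons by (intro subspace_add subspace_scale stable_subspace stable_u)
qed (simp add: subspace_0 stable_subspace)

lemma stable_comb: "stable S \<Longrightarrow> x \<in> S \<Longrightarrow> act f x + act g (b x) \<in> S"
  by (intro subspace_add stable_subspace stable_act stable_b)

text \<open>\<open>conj f - g b\<close> inverts \<open>f + g b\<close> on the left up to a unit: their product is the reduced norm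
  \<open>conj f f - Q g conj g\<close>, congruent to \<open>f\<^sup>2 - Q g\<^sup>2\<close> modulo \<open>r\<close>.\<close>

lemma unit_mem:
  assumes S: "stable S" and fg: "\<not> (r dvd f \<and> r dvd g)" and mem: "act f x + act g (b x) \<in> S"
  shows "x \<in> S"
proof -
  let ?n = "conj f * f - smult Q (g * conj g)"
  have "f\<^sup>2 - smult Q (g\<^sup>2) = ?n - ((conj f - f) * f - smult Q (g * (conj g - g)))"
    by (simp add: algebra_simps power2_eq_square smult_diff_right)
  moreover have "r dvd (conj f - f) * f - smult Q (g * (conj g - g))"
    by (intro dvd_diff dvd_smult dvd_mult2 dvd_mult dvd_conj_diff)
  ultimately have "\<not> r dvd ?n"
    using anisotropic[of f g] fg by (metis dvd_diff)
  then obtain k where k: "\<forall>v. act k (act ?n v) = v"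
    using invertible_act by blast
  let ?y = "act f x + act g (b x)"
  have "act (conj f) ?y - act g (b ?y) = act ?n x"
    by (simp add: act_linear_simps linear_add[OF linear_b] b_act b_b act_diff act_smult act_mult
        act_commute[of "conj f" g])
  moreover have "act (conj f) ?y - act g (b ?y) \<in> S"
    by (intro subspace_diff stable_subspace[OF S] stable_act[OF S] stable_b[OF S] mem)
  ultimately have "act k (act ?n x) \<in> S"
    using stable_act[OF S] by simp
  then show ?thesis using k by simp
qed

text \<open>Conjugating \<open>r(u) = u^2 - \<delta>\<close> by \<open>b\<close> gives
  \<open>\<delta>^2 u^-2 - \<delta>\<close>, which is \<open>r(u)\<close> up to the invertible
  factor \<open>- \<delta> u^-2\<close>. Therefore \<open>b\<close> preserves the kernels of the
  powers of \<open>r(u)\<close>.\<close>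

lemma act_r_b: "act r (b x) = act [:0, 0, - inverse \<delta>:] (b (act r x))"
proof -
  have "u (u (b (u (u x)))) = scale \<delta> (scale \<delta> (b x))"
    by (simp add: u_b_u linear_scale[OF linear_u])
  then have "u (u (b (act r x))) = - scale \<delta> (act r (b x))"
    by (simp add: act_r linear_diff[OF linear_b] linear_scale[OF linear_b] linear_diff[OF linear_u]
        linear_scale[OF linear_u] scale_right_diff_distrib)
  then have "scale (inverse \<delta>) (u (u (b (act r x)))) = - act r (b x)"
    using \<delta>_nonzero by simp
  then show ?thesis
    by (simp add: act_pCons linear_0[OF linear_u] linear_scale[OF linear_u] linear_neg[OF linear_u])
qed

lemma act_r_power_b: "act (r ^ k) (b x) = act ([:0, 0, - inverse \<delta>:] ^ k) (b (act (r ^ k) x))"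
proof (induction k arbitrary: x)
  case (Suc k)
  have "act (r ^ Suc k) (b x) = act (r ^ k) (act r (b x))"
    by (simp only: power_Suc2 act_mult)
  also have "\<dots> = act [:0, 0, - inverse \<delta>:] (act (r ^ k) (b (act r x)))"
    by (simp only: act_r_b[of x] act_commute[of "r ^ k"])
  also have "\<dots> = act [:0, 0, - inverse \<delta>:]
      (act ([:0, 0, - inverse \<delta>:] ^ k) (b (act (r ^ k) (act r x))))"
    by (simp only: Suc)
  also have "\<dots> = act ([:0, 0, - inverse \<delta>:] ^ Suc k) (b (act (r ^ Suc k) x))"
    by (simp only: power_Suc act_mult act_commute[of r "r ^ k"])
  finally show ?case .
qed simp

lemma stable_kernel: "stable {x. act (r ^ k) x = 0}"
  unfolding stable_def
  by (auto intro!: subspaceI simp: act_linear_simps act_u linear_0[OF linear_u] act_r_power_b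
      linear_0[OF linear_b])

section \<open>Sums, cyclic submodules and complements\<close>

definition sum_space :: "'v set \<Rightarrow> 'v set \<Rightarrow> 'v set" where
  "sum_space S T = {x + y | x y. x \<in> S \<and> y \<in> T}"

lemma sum_spaceI: "x \<in> S \<Longrightarrow> y \<in> T \<Longrightarrow> x + y \<in> sum_space S T"
  by (auto simp: sum_space_def)

lemma sum_spaceE:
  assumes "w \<in> sum_space S T"
  obtains x y where "x \<in> S" "y \<in> T" "w = x + y"
  using assms by (auto simp: sum_space_def)

lemma stable_sum:
  assumes S: "stable S" and T: "stable T"
  shows "stable (sum_space S T)"
  unfolding stable_def
proof
  show "subspace (sum_space S T)"
    unfolding sum_space_def using assms by (intro subspace_sums stable_subspace)
  show "\<forall>w\<in>sum_space S T. u w \<in> sum_space S T \<and> b w \<in> sum_space S T"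
  proof
    fix w assume "w \<in> sum_space S T"
    then obtain x y where "x \<in> S" "y \<in> T" "w = x + y" by (rule sum_spaceE)
    then show "u w \<in> sum_space S T \<and> b w \<in> sum_space S T"
      by (simp add: linear_add[OF linear_u] linear_add[OF linear_b] sum_spaceI
          stable_u[OF S] stable_u[OF T] stable_b[OF S] stable_b[OF T])
  qed
qed

lemma sum_space_subset:
  assumes "stable U" "S \<subseteq> U" "T \<subseteq> U"
  shows "sum_space S T \<subseteq> U"
proof
  fix w assume "w \<in> sum_space S T"
  then obtain x y where "x \<in> S" "y \<in> T" "w = x + y" by (rule sum_spaceE)
  then show "w \<in> U"
    using assms subspace_add[OF stable_subspace[OF assms(1)], of x y] by auto
qed

lemma subset_sum_space:
  assumes "stable S" "stable T"
  shows "S \<subseteq> sum_space S T" "T \<subseteq> sum_space S T"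
  using sum_spaceI[of _ S 0 T] sum_spaceI[of 0 S _ T] assms
  by (auto simp: subspace_0 stable_subspace)

text \<open>The submodule generated by \<open>v\<close>: since \<open>b\<close> squares to a scalar
  and moves past \<open>u\<close> through \<open>conj\<close>, every element of the algebra has the
  form \<open>f(u) + g(u) b\<close>.\<close>

definition gen :: "'v \<Rightarrow> 'v set" where
  "gen v = {act f v + act g (b v) | f g. True}"

lemma genI: "act f v + act g (b v) \<in> gen v"
  by (auto simp: gen_def)

lemma gen_self: "v \<in> gen v"
  using genI[of 1 v 0] by simp

lemma stable_gen: "stable (gen v)"
  unfolding stable_def
proof
  show "subspace (gen v)"
  proof (rule subspaceI)
    show "0 \<in> gen v" using genI[of 0 v 0] by simp
  next
    fix x y assume "x \<in> gen v" "y \<in> gen v"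
    then obtain f g f' g' where "x = act f v + act g (b v)" "y = act f' v + act g' (b v)"
      by (auto simp: gen_def)
    then show "x + y \<in> gen v"
      using genI[of "f + f'" v "g + g'"] by (simp add: act_add algebra_simps)
  next
    fix c x assume "x \<in> gen v"
    then obtain f g where "x = act f v + act g (b v)"
      by (auto simp: gen_def)
    then show "scale c x \<in> gen v"
      using genI[of "smult c f" v "smult c g"] by (simp add: act_smult scale_right_distrib)
  qed
  show "\<forall>x\<in>gen v. u x \<in> gen v \<and> b x \<in> gen v"
  proof
    fix x assume "x \<in> gen v"
    then obtain f g where x: "x = act f v + act g (b v)"
      by (auto simp: gen_def)
    have "u x = act ([:0, 1:] * f) v + act ([:0, 1:] * g) (b v)"
      by (simp add: x linear_add[OF linear_u] act_mult del: mult_pCons_left)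
    moreover have "b x = act (smult Q (conj g)) v + act (conj f) (b v)"
      by (simp add: x linear_add[OF linear_b] b_act b_b act_linear_simps act_smult)
    ultimately show "u x \<in> gen v \<and> b x \<in> gen v" using genI by metis
  qed
qed

lemma gen_subset: "stable S \<Longrightarrow> v \<in> S \<Longrightarrow> gen v \<subseteq> S"
  by (auto simp: gen_def stable_comb)

text \<open>Otherwise take the least \<open>k\<close> for which \<open>r ^ k\<close> does not divide
  both. Factoring out \<open>r ^ (k - 1)\<close> leaves an invertible combination, so
  \<open>unit_mem\<close>, applied to the kernel of \<open>r(u) ^ (k - 1)\<close>, puts
  \<open>v\<close> in that kernel. As \<open>k - 1 \<le> m\<close>, this contradicts the choice of
  \<open>v\<close>.\<close>

lemma annihilator_gen:
  assumes v: "act (r ^ m) v \<noteq> 0" and fg: "act f v + act g (b v) = 0"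
  shows "r ^ Suc m dvd f \<and> r ^ Suc m dvd g"
proof (rule ccontr)
  let ?P = "\<lambda>k. \<not> (r ^ k dvd f \<and> r ^ k dvd g)"
  assume "?P (Suc m)"
  then obtain k where k: "k \<le> Suc m" "?P k" "\<forall>j<k. \<not> ?P j"
    by (rule obtain_least_nat[of ?P])
  have "k \<noteq> 0" using k(2) by (metis one_dvd power_0)
  then obtain j where j: "k = Suc j" using not0_implies_Suc by blast
  then have "\<not> ?P j" using k(3) lessI by blast
  then obtain f' g' where f': "f = r ^ j * f'" "g = r ^ j * g'"
    unfolding dvd_def by blast
  have "\<not> (r dvd f' \<and> r dvd g')"
  proof
    assume "r dvd f' \<and> r dvd g'"
    then have "r ^ k dvd f" "r ^ k dvd g"
      unfolding j f' power_Suc2 by (auto intro: mult_dvd_mono)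
    with k(2) show False by blast
  qed
  moreover have "act f' v + act g' (b v) \<in> {x. act (r ^ j) x = 0}"
    using fg by (simp add: f' act_mult act_linear_simps)
  ultimately have "v \<in> {x. act (r ^ j) x = 0}"
    by (rule unit_mem[OF stable_kernel])
  then have "act (r ^ j) v = 0" by simp
  then have "act (r ^ m) v = 0"
    using act_power_le j k(1) by simp
  with v show False ..
qed

text \<open>\<open>annihilator_gen\<close> shows at once that \<open>v\<close> and
  \<open>b v\<close> both have annihilator \<open>r ^ Suc m\<close> and that their cyclic spaces
  meet trivially.\<close>

lemma list_basis_gen:
  assumes v: "act (r ^ m) v \<noteq> 0" and "act (r ^ Suc m) v = 0" "act (r ^ Suc m) (b v) = 0"
  shows "list_basis scale (gen v) (orbits [(r ^ Suc m, v), (r ^ Suc m, b v)])"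
proof -
  have "list_basis scale (range (\<lambda>g. act g v)) (orbit u v (Polynomial.degree (r ^ Suc m)))"
    using assms annihilator_gen[OF v, of _ 0] by (intro list_basis_orbit) auto
  moreover have "list_basis scale (range (\<lambda>g. act g (b v))) (orbit u (b v) (Polynomial.degree (r ^ Suc m)))"
    using assms annihilator_gen[OF v, of 0] by (intro list_basis_orbit) auto
  moreover have "range (\<lambda>g. act g v) \<inter> range (\<lambda>g. act g (b v)) \<subseteq> {0}"
  proof
    fix w assume "w \<in> range (\<lambda>g. act g v) \<inter> range (\<lambda>g. act g (b v))"
    then obtain f g where w: "w = act f v" "w = act g (b v)" by blast
    then have "act f v + act (- g) (b v) = 0" by (simp add: act_minus)
    then have "r ^ Suc m dvd f" using annihilator_gen[OF v] by blast
    with assms(2) have "act f v = 0" by (rule act_dvd)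
    then show "w \<in> {0}" using w by simp
  qed
  ultimately have "list_basis scale
      {x + y | x y. x \<in> range (\<lambda>g. act g v) \<and> y \<in> range (\<lambda>g. act g (b v))}
      (orbit u v (Polynomial.degree (r ^ Suc m)) @ orbit u (b v) (Polynomial.degree (r ^ Suc m)))"
    by (rule list_basis_append)
  moreover have "{x + y | x y. x \<in> range (\<lambda>g. act g v) \<and> y \<in> range (\<lambda>g. act g (b v))} = gen v"
    by (auto simp: gen_def)
  ultimately show ?thesis by simp
qed

text \<open>Any stable subspace maximal among those meeting \<open>gen v\<close> trivially is a complement.\<close>

lemma stable_complement:
  assumes S: "stable S" and m: "\<And>x. x \<in> S \<Longrightarrow> act (r ^ Suc m) x = 0"
    and v: "v \<in> S" "act (r ^ m) v \<noteq> 0"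
  shows "\<exists>T. stable T \<and> gen v \<inter> T \<subseteq> {0} \<and> sum_space (gen v) T = S"
proof -
  let ?M = "gen v"
  let ?P = "\<lambda>T. stable T \<and> T \<subseteq> S \<and> ?M \<inter> T \<subseteq> {0}"
  have "?P {0}"
    using stable_subspace[OF S]
    by (auto simp: stable_def linear_0[OF linear_u] linear_0[OF linear_b] subspace_0)
  then obtain T where T: "?P T" and max: "\<And>T'. ?P T' \<Longrightarrow> dim T' \<le> dim T"
  proof -
    \<comment> \<open>Dimensions are bounded, so an admissible \<open>T\<close> of greatest
      dimension exists.\<close>
    have "\<exists>T. ?P T \<and> (\<forall>T'. ?P T' \<longrightarrow> dim T' \<le> dim T)"
      using \<open>?P {0}\<close> dim_subset_UNIV
      by (intro Lattices_Big.ex_has_greatest_nat[of ?P "{0}" dim "Suc dimension"])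
        (auto simp: le_imp_less_Suc)
    then show ?thesis using that by blast
  qed
  then have sT: "stable T" and TS: "T \<subseteq> S" and MT: "?M \<inter> T \<subseteq> {0}" by auto
  let ?W = "sum_space ?M T"
  have W: "stable ?W" by (intro stable_sum stable_gen sT)
  have MS: "?M \<subseteq> S" by (rule gen_subset[OF S v(1)])
  have WS: "?W \<subseteq> S"
    by (rule sum_space_subset[OF S MS TS])
  note MW = subset_sum_space(1)[OF stable_gen sT] and TW = subset_sum_space(2)[OF stable_gen sT]
  have "S \<subseteq> ?W"
  proof (rule ccontr)
    assume "\<not> S \<subseteq> ?W"
    then obtain x0 where x0: "x0 \<in> S" "x0 \<notin> ?W" by blast
    have "act (r ^ Suc m) x0 \<in> ?W"
      using m[OF x0(1)] subspace_0[OF stable_subspace[OF W]] by simp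
    \<comment> \<open>The step just before the powers of \<open>r(u)\<close> bring \<open>x0\<close>
      into \<open>?W\<close> gives \<open>x1\<close> outside \<open>?W\<close> with
      \<open>r(u) x1\<close> inside.\<close>
    then obtain k where "k \<le> Suc m" and k: "act (r ^ k) x0 \<in> ?W" "\<forall>j<k. act (r ^ j) x0 \<notin> ?W"
      by (rule obtain_least_nat[of "\<lambda>k. act (r ^ k) x0 \<in> ?W"])
    then obtain j where j: "k = Suc j" using x0 by (cases k) auto
    define x1 where "x1 = act (r ^ j) x0"
    have x1: "x1 \<in> S" "x1 \<notin> ?W"
      using stable_act[OF S x0(1)] k(2) j by (simp_all add: x1_def)
    have "act r x1 \<in> ?W"
      using k(1) by (simp add: x1_def j act_mult)
    then obtain m1 y where m1: "m1 \<in> ?M" and y: "y \<in> T" and rx1: "act r x1 = m1 + y"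
      by (rule sum_spaceE)
    \<comment> \<open>\<open>r ^ Suc m\<close> kills \<open>x1\<close>, so the two components of
      \<open>r(u) ^ m\<close> applied to \<open>r(u) x1\<close> cancel; since \<open>?M\<close> and
      \<open>T\<close> meet trivially, each is zero.\<close>
    have "act (r ^ m) m1 + act (r ^ m) y = 0"
      using m[OF x1(1)] by (simp add: power_Suc2 act_mult rx1 act_linear_simps del: power_Suc)
    then have "act (r ^ m) m1 = - act (r ^ m) y"
      by (simp add: eq_neg_iff_add_eq_0)
    moreover have "- act (r ^ m) y \<in> T"
      using stable_act[OF sT y] subspace_neg[OF stable_subspace[OF sT]] by blast
    moreover have "act (r ^ m) m1 \<in> ?M"
      by (rule stable_act[OF stable_gen m1])
    ultimately have rm1: "act (r ^ m) m1 = 0" using MT by auto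
    obtain f g where fg: "m1 = act f v + act g (b v)"
      using m1 by (auto simp: gen_def)
    have "act (r ^ m * f) v + act (r ^ m * g) (b v) = 0"
      using rm1 by (simp add: fg act_mult act_linear_simps)
    then have "r ^ Suc m dvd r ^ m * f \<and> r ^ Suc m dvd r ^ m * g"
      by (rule annihilator_gen[OF v(2)])
    then have "r dvd f" "r dvd g" by (simp_all add: power_Suc2 del: power_Suc)
    then obtain f1 g1 where f1: "f = r * f1" "g = r * g1" by (auto elim!: dvdE)
    \<comment> \<open>As \<open>r ^ m\<close> kills \<open>m1\<close>, it is \<open>r(u)\<close> of
      an element of \<open>gen v\<close>. Subtracting that element from \<open>x1\<close> brings
      \<open>r(u) x\<close> into \<open>T\<close>, while \<open>x\<close> stays outside
      \<open>?W\<close>.\<close>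
    define x where "x = x1 - (act f1 v + act g1 (b v))"
    have rx: "act r x = y"
      by (simp add: x_def act_linear_simps rx1 fg f1 act_mult)
    have xS: "x \<in> S"
      unfolding x_def using genI MS by (intro subspace_diff stable_subspace[OF S] x1(1)) blast
    have xW: "x \<notin> ?W"
    proof
      assume "x \<in> ?W"
      then have "x + (act f1 v + act g1 (b v)) \<in> ?W"
        by (rule subspace_add[OF stable_subspace[OF W]]) (use genI MW in blast)
      then show False using x1(2) by (simp add: x_def)
    qed
    let ?T' = "sum_space (gen x) T"
    have T': "stable ?T'" by (intro stable_sum stable_gen sT)
    have "?T' \<subseteq> S"
      by (rule sum_space_subset[OF S gen_subset[OF S xS] TS])
    moreover have "?M \<inter> ?T' \<subseteq> {0}"
    proof
      fix w assume w: "w \<in> ?M \<inter> ?T'"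
      then obtain f g y' where w': "w = act f x + act g (b x) + y'" and y': "y' \<in> T"
        by (auto simp: gen_def elim!: sum_spaceE)
      show "w \<in> {0}"
      \<comment> \<open>Either both coefficients contain \<open>r\<close> and
        \<open>r(u) x = y\<close> puts \<open>w\<close> in \<open>T\<close>, or the combination is
        invertible and \<open>x\<close> would lie in \<open>?W\<close>.\<close>
      proof (cases "r dvd f \<and> r dvd g")
        case True
        then obtain f2 g2 where "f = r * f2" "g = r * g2" by (auto elim!: dvdE)
        then have "w = act f2 y + act g2 (act r (b x)) + y'"
          by (simp add: w' act_mult rx act_commute[of r])
        also have "act r (b x) = act [:0, 0, - inverse \<delta>:] (b y)"
          by (simp only: act_r_b rx)
        finally have w_eq: "w = act f2 y + act g2 (act [:0, 0, - inverse \<delta>:] (b y)) + y'" .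
        have "w \<in> T"
          unfolding w_eq
          by (intro subspace_add stable_subspace[OF sT] stable_act[OF sT] stable_b[OF sT] y y')
        then show ?thesis using w MT by blast
      next
        case False
        have "w - y' \<in> ?W"
          using subspace_diff[OF stable_subspace[OF W], of w y'] w y' MW TW by blast
        then have "act f x + act g (b x) \<in> ?W" by (simp add: w')
        then have "x \<in> ?W" by (rule unit_mem[OF W False])
        with xW show ?thesis ..
      qed
    qed
    ultimately have "dim ?T' \<le> dim T" using max T' by blast
    moreover have "T \<subset> ?T'"
    proof
      show "T \<subseteq> ?T'"
        by (rule subset_sum_space(2)[OF stable_gen sT])
      have "x \<in> ?T'"
        using gen_self[of x] subset_sum_space(1)[OF stable_gen sT] by blast
      then show "T \<noteq> ?T'" using xW TW by blast
    qed
    then have "dim T < dim ?T'"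
      using sT T' by (intro dim_psubset) (metis span_eq_iff stable_subspace)
    ultimately show False by simp
  qed
  then have "?W = S" using WS by blast
  then show ?thesis using sT MT by blast
qed

text \<open>Induction on the dimension: a vector whose annihilator has the largest exponent on
  \<open>S\<close> generates a submodule with basis given by \<open>v\<close> and
  \<open>b v\<close>, and the induction continues on a stable complement.\<close>

lemma stable_decomposition:
  assumes "stable S"
  shows "\<exists>ts. (\<forall>(n, v, w)\<in>set ts. 0 < n \<and> act (r ^ n) v = 0 \<and> act (r ^ n) w = 0) \<and>
              list_basis scale S (paired_orbits r ts)"
  using assms
proof (induction "dim S" arbitrary: S rule: less_induct)
  case less
  show ?case
  proof (cases "S = {0}")
    case True
    then show ?thesis
      by (intro exI[of _ "[]"]) (simp add: paired_orbits_def list_basis_def independent_empty)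
  next
    case False
    note S = less.prems
    have zero: "0 \<in> S" using S by (simp add: stable_subspace subspace_0)
    let ?P = "\<lambda>n. \<forall>x\<in>S. act (r ^ n) x = 0"
    have "?P N" by (simp add: nilpotent)
    \<comment> \<open>With \<open>n\<close> least, some \<open>v\<close> in \<open>S\<close> is not
      killed by \<open>r ^ (n - 1)\<close>, as \<open>stable_complement\<close> requires.\<close>
    then obtain n where "n \<le> N" and n: "?P n" "\<forall>j<n. \<not> ?P j"
      by (rule obtain_least_nat[of ?P])
    have "n \<noteq> 0" using n(1) False zero by auto
    then obtain m where m: "n = Suc m" by (cases n) auto
    then obtain v where v: "v \<in> S" "act (r ^ m) v \<noteq> 0" using n(2) by auto
    obtain T where T: "stable T" "gen v \<inter> T \<subseteq> {0}" "sum_space (gen v) T = S"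
      using stable_complement[OF S _ v] n(1) m by blast
    have "T \<subset> S"
    proof
      show "T \<subseteq> S"
        unfolding T(3)[symmetric] by (rule subset_sum_space(2)[OF stable_gen T(1)])
      have "v \<noteq> 0" using v(2) by (auto simp: act_linear_simps)
      then have "v \<notin> T" using gen_self T(2) by blast
      then show "T \<noteq> S" using v(1) by blast
    qed
    then have "dim T < dim S"
      using S T(1) by (intro dim_psubset) (metis span_eq_iff stable_subspace)
    from less.hyps[OF this T(1)] obtain ts
      where ts: "\<forall>(n, v, w)\<in>set ts. 0 < n \<and> act (r ^ n) v = 0 \<and> act (r ^ n) w = 0"
        "list_basis scale T (paired_orbits r ts)"
      by blast
    have ann: "act (r ^ Suc m) v = 0" "act (r ^ Suc m) (b v) = 0"
      using n(1) m v(1) stable_b[OF S] by auto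
    have "list_basis scale S (orbits [(r ^ Suc m, v), (r ^ Suc m, b v)] @ paired_orbits r ts)"
      using list_basis_append[OF list_basis_gen[OF v(2) ann] ts(2) T(2)] T(3) by (simp add: sum_space_def)
    then have "list_basis scale S (paired_orbits r ((Suc m, v, b v) # ts))"
      by (simp add: paired_orbits_def)
    with ts(1) ann show ?thesis
      by (intro exI[of _ "(Suc m, v, b v) # ts"]) auto
  qed
qed

end

section \<open>Constructing \<open>b\<close> from paired blocks\<close>

lemma map_concat_eqD:
  assumes "map g (concat (map F xs)) = concat (map G xs)"
    and "\<And>x. x \<in> set xs \<Longrightarrow> length (F x) = length (G x)" and "x \<in> set xs"
  shows "map g (F x) = G x"
  using assms by (induction xs) auto

context endomorphism
begin

lemma paired_orbits_concat:
  "paired_orbits r ts = concat (map (\<lambda>(n, v, w).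
     orbit u v (Polynomial.degree (r ^ n)) @ orbit u w (Polynomial.degree (r ^ n))) ts)"
  by (induction ts) (auto simp: paired_orbits_def)

lemma paired_orbits_mem:
  "x \<in> set (paired_orbits r ts) \<Longrightarrow>
     \<exists>n v w i. (n, v, w) \<in> set ts \<and> (x = (u ^^ i) v \<or> x = (u ^^ i) w)"
  by (fastforce simp: paired_orbits_concat orbit_def)

text \<open>Generators of consecutive equal blocks are regrouped into triples.\<close>

lemma ex_paired_iff:
  "(\<exists>ps. map fst ps = concat (map (\<lambda>n. [r ^ n, r ^ n]) ns) \<and> bs = orbits ps \<and>
      (\<forall>(f, v)\<in>set ps. act f v = 0)) \<longleftrightarrow>
   (\<exists>ts. map fst ts = ns \<and> bs = paired_orbits r ts \<and>
      (\<forall>(n, v, w)\<in>set ts. act (r ^ n) v = 0 \<and> act (r ^ n) w = 0))" (is "?L \<longleftrightarrow> ?R")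
proof
  assume ?L
  then obtain ps where "map fst ps = concat (map (\<lambda>n. [r ^ n, r ^ n]) ns)"
    and "bs = orbits ps" and "\<forall>(f, v)\<in>set ps. act f v = 0" by blast
  then show ?R
  proof (induction ns arbitrary: ps bs)
    case Nil
    then show ?case by (simp add: paired_orbits_def)
  next
    case (Cons n ns)
    from Cons.prems(1) obtain v w qs where ps: "ps = (r ^ n, v) # (r ^ n, w) # qs"
      and qs: "map fst qs = concat (map (\<lambda>n. [r ^ n, r ^ n]) ns)"
      by (auto simp: map_eq_Cons_conv)
    obtain ts where ts: "map fst ts = ns" "orbits qs = paired_orbits r ts"
      "\<forall>(n, v, w)\<in>set ts. act (r ^ n) v = 0 \<and> act (r ^ n) w = 0"
      using Cons.IH[OF qs refl] Cons.prems(3) ps by auto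
    show ?case
      using ts Cons.prems(2,3) ps
      by (intro exI[of _ "(n, v, w) # ts"]) (simp add: paired_orbits_def)
  qed
next
  assume ?R
  then obtain ts where ns: "map fst ts = ns" and bs: "bs = paired_orbits r ts"
    and ts: "\<forall>(n, v, w)\<in>set ts. act (r ^ n) v = 0 \<and> act (r ^ n) w = 0" by blast
  let ?ps = "concat (map (\<lambda>(n, v, w). [(r ^ n, v), (r ^ n, w)]) ts)"
  have "map fst ?ps = concat (map (\<lambda>n. [r ^ n, r ^ n]) (map fst ts))"
    by (induction ts) auto
  moreover have "\<forall>(f, v)\<in>set ?ps. act f v = 0"
    using ts by (induction ts) auto
  ultimately show ?L
    using ns bs unfolding paired_orbits_def by blast
qed

lemma represented_by_paired_blocks_iff:
  assumes "lead_coeff r = 1"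
  shows "(\<exists>bs ns. (\<forall>n\<in>set ns. 0 < n) \<and> represented_by scale u bs
            (diag_block_mat (map (\<lambda>n. diag_block_mat [companion_mat (r ^ n), companion_mat (r ^ n)]) ns))) \<longleftrightarrow>
         (\<exists>ts. (\<forall>(n, v, w)\<in>set ts. 0 < n \<and> act (r ^ n) v = 0 \<and> act (r ^ n) w = 0) \<and>
            list_basis scale UNIV (paired_orbits r ts))"
proof -
  have blocks: "diag_block_mat (map (\<lambda>n. diag_block_mat [companion_mat (r ^ n), companion_mat (r ^ n)]) ns) =
      diag_block_mat (map companion_mat (concat (map (\<lambda>n. [r ^ n, r ^ n]) ns)))" for ns
    unfolding diag_block_mat_concat[of "\<lambda>n. [companion_mat (r ^ n), companion_mat (r ^ n)]"]
    by (simp add: map_concat o_def)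
  have "\<forall>f\<in>set (concat (map (\<lambda>n. [r ^ n, r ^ n]) ns)). lead_coeff f = 1" for ns
    using assms by (auto simp: lead_coeff_power)
  note acts = acts_by_diag_companion_mat_iff[OF this]
  show ?thesis
    unfolding blocks represented_by_iff acts ordered_basis_iff ex_paired_iff
  proof (intro iffI; elim exE conjE)
    fix bs ns ts
    assume pos: "\<forall>n\<in>set ns. 0 < n" and bs: "list_basis scale UNIV bs" "bs = paired_orbits r ts"
      and ns: "map fst ts = ns"
      and ann: "\<forall>(n, v, w)\<in>set ts. act (r ^ n) v = 0 \<and> act (r ^ n) w = 0"
    have "0 < n" if "(n, v, w) \<in> set ts" for n v w
      using pos that unfolding ns[symmetric] by force
    with ann bs show "\<exists>ts. (\<forall>(n, v, w)\<in>set ts. 0 < n \<and> act (r ^ n) v = 0 \<and> act (r ^ n) w = 0) \<and>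
        list_basis scale UNIV (paired_orbits r ts)"
      by (intro exI[of _ ts]) auto
  next
    fix ts
    assume "\<forall>(n, v, w)\<in>set ts. 0 < n \<and> act (r ^ n) v = 0 \<and> act (r ^ n) w = 0"
      "list_basis scale UNIV (paired_orbits r ts)"
    then show "\<exists>bs ns. (\<forall>n\<in>set ns. 0 < n) \<and> list_basis scale UNIV bs \<and>
        (\<exists>ts. map fst ts = ns \<and> bs = paired_orbits r ts \<and>
          (\<forall>(n, v, w)\<in>set ts. act (r ^ n) v = 0 \<and> act (r ^ n) w = 0))"
      by (intro exI[of _ "paired_orbits r ts"] exI[of _ "map fst ts"] conjI exI[of _ ts]) auto
  qed
qed

end

context primary_endomorphism
begin

text \<open>The values of \<open>b\<close> are prescribed only on the basis vectors of the orbit.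
  Reduction modulo \<open>r ^ n\<close> extends the formula to all \<open>f\<close>, as
  \<open>r ^ n\<close> kills both \<open>v\<close> and \<open>w\<close> and conjugation respects
  divisibility by it.\<close>

lemma linear_conj_act:
  assumes b: "Vector_Spaces.linear scale scale b" and v: "act (r ^ n) v = 0" and w: "act (r ^ n) w = 0"
    and b_orbit: "\<And>i. i < Polynomial.degree (r ^ n) \<Longrightarrow> b ((u ^^ i) v) = act (conj_X ^ i) w"
  shows "b (act f v) = act (conj f) w"
proof -
  let ?d = "Polynomial.degree (r ^ n)"
  have ind: "b (act g v) = act (conj g) w" if "\<And>i. i \<ge> ?d \<Longrightarrow> Polynomial.coeff g i = 0" for g
  proof -
    have monom: "conj (Polynomial.monom c i) = smult c (conj_X ^ i)" for c i
      by (simp add: monom_altdef conj_def pcompose_smult conj_power[unfolded conj_def])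
    have g: "g = (\<Sum>i<?d. Polynomial.monom (Polynomial.coeff g i) i)"
      by (rule poly_eqI) (use that in \<open>simp add: coeff_sum not_less\<close>)
    have "b (act g v) = (\<Sum>i<?d. scale (Polynomial.coeff g i) (b ((u ^^ i) v)))"
      by (subst g) (simp add: act_sum act_monom linear_sum[OF b] linear_scale[OF b])
    also have "\<dots> = act (\<Sum>i<?d. conj (Polynomial.monom (Polynomial.coeff g i) i)) w"
      by (simp add: act_sum monom act_smult b_orbit)
    also have "(\<Sum>i<?d. conj (Polynomial.monom (Polynomial.coeff g i) i)) = conj g"
      by (subst (2) g) (simp add: conj_def pcompose_sum)
    finally show ?thesis .
  qed
  have "r ^ n \<noteq> 0" by simp
  then have coeffs: "Polynomial.coeff (f mod r ^ n) i = 0" if "i \<ge> ?d" for i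
    using degree_mod_less[of "r ^ n" f] that by (cases "f mod r ^ n = 0") (simp_all add: coeff_eq_0)
  have "act (f - f mod r ^ n) v = 0" "act (conj (f - f mod r ^ n)) w = 0"
    by (rule act_dvd[OF v dvd_minus_mod], rule act_dvd[OF w dvd_conj_power[OF dvd_minus_mod]])
  then have "act f v = act (f mod r ^ n) v" "act (conj f) w = act (conj (f mod r ^ n)) w"
    by (simp_all add: act_diff conj_diff)
  then show ?thesis using ind[of "f mod r ^ n"] coeffs by simp
qed

text \<open>On each pair, \<open>b\<close> exchanges \<open>v\<close> and \<open>w\<close> up to
  \<open>Q\<close> and conjugates coefficients. Then \<open>b^2 = Q\<close> because conjugation is
  involutive, and \<open>u b u = \<delta> b\<close> because \<open>X * conj_X\<close> acts as
  \<delta>.\<close>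

lemma ex_twisting_map:
  assumes ann: "\<forall>(n, v, w)\<in>set ts. act (r ^ n) v = 0 \<and> act (r ^ n) w = 0"
    and basis: "list_basis scale UNIV (paired_orbits r ts)"
  shows "\<exists>b. Vector_Spaces.linear scale scale b \<and> (\<forall>x. b (b x) = scale Q x) \<and>
             (\<forall>x. u (b (u x)) = scale \<delta> (b x))"
proof -
  let ?F = "\<lambda>(n, v, w). orbit u v (Polynomial.degree (r ^ n)) @ orbit u w (Polynomial.degree (r ^ n))"
  let ?O = "\<lambda>n x. map (\<lambda>i. act (conj_X ^ i) x) [0..<Polynomial.degree (r ^ n)]"
  \<comment> \<open>The prescribed images, in the order of the basis \<open>?F\<close>:
    \<open>u^i v\<close> goes to \<open>conj_X^i w\<close>, and \<open>u^i w\<close> to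
    \<open>Q\<close> times \<open>conj_X^i v\<close>.\<close>
  let ?G = "\<lambda>(n, v, w). ?O n w @ ?O n (scale Q v)"
  let ?bs = "concat (map ?F ts)" and ?ys = "concat (map ?G ts)"
  have bs: "list_basis scale UNIV ?bs" using basis by (simp only: paired_orbits_concat)
  have len: "length ?bs = length ?ys"
    by (induction ts) auto
  obtain b where b: "Vector_Spaces.linear scale scale b"
    and nth: "\<And>i. i < length ?bs \<Longrightarrow> b (?bs ! i) = ?ys ! i"
    using linear_extend_list[OF bs, of "\<lambda>i. ?ys ! i"] by blast
  have "map b ?bs = ?ys"
    by (rule nth_equalityI) (use len nth in simp_all)
  then have map_b: "map b (?F t) = ?G t" if "t \<in> set ts" for t
    by (rule map_concat_eqD) (use that in auto)
  have bvw: "b (act f v) = act (conj f) w \<and> b (act f w) = act (conj f) (scale Q v)"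
    if t: "(n, v, w) \<in> set ts" for n v w f
  proof -
    let ?d = "Polynomial.degree (r ^ n)"
    have eqs: "map b (orbit u v ?d) = ?O n w \<and> map b (orbit u w ?d) = ?O n (scale Q v)"
      using map_b[OF t] by simp
    have i: "b ((u ^^ i) v) = act (conj_X ^ i) w" "b ((u ^^ i) w) = act (conj_X ^ i) (scale Q v)"
      if "i < ?d" for i
      using that arg_cong[OF eqs[THEN conjunct1], of "\<lambda>xs. xs ! i"]
        arg_cong[OF eqs[THEN conjunct2], of "\<lambda>xs. xs ! i"] by simp_all
    have "act (r ^ n) v = 0" "act (r ^ n) w = 0" using ann t by auto
    then show ?thesis
      using linear_conj_act[OF b _ _ i(1)] linear_conj_act[OF b _ _ i(2)]
      by (simp add: linear_scale[OF linear_act])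
  qed
  have dest: "\<exists>n v w i. (n, v, w) \<in> set ts \<and> (x = act ([:0, 1:] ^ i) v \<or> x = act ([:0, 1:] ^ i) w)"
    if "x \<in> set ?bs" for x
    using paired_orbits_mem[of x r ts] that unfolding paired_orbits_concat act_X_power by blast
  have span: "x \<in> span (set ?bs)" for x
    using bs by (simp add: list_basis_def)
  have "b (b x) = scale Q x" for x
  proof (rule linear_eq_on_span[OF _ _ _ span, of "\<lambda>x. b (b x)" "scale Q"])
    show "Vector_Spaces.linear scale scale (\<lambda>x. b (b x))"
      using Vector_Spaces.linear_compose[OF b b] by (simp add: o_def)
    show "Vector_Spaces.linear scale scale (scale Q)" by (rule linear_scale_self)
    fix x assume "x \<in> set ?bs"
    then obtain n v w i where "(n, v, w) \<in> set ts"
      and "x = act ([:0, 1:] ^ i) v \<or> x = act ([:0, 1:] ^ i) w" using dest by blast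
    then show "b (b x) = scale Q x"
      using bvw by (auto simp: act_conj_conj linear_scale[OF linear_act] linear_scale[OF b])
  qed
  moreover have "u (b (u x)) = scale \<delta> (b x)" for x
  proof (rule linear_eq_on_span[OF _ _ _ span, of "\<lambda>x. u (b (u x))" "\<lambda>x. scale \<delta> (b x)"])
    show "Vector_Spaces.linear scale scale (\<lambda>x. u (b (u x)))"
      using Vector_Spaces.linear_compose[OF linear_u Vector_Spaces.linear_compose[OF b linear_u]]
      by (simp add: o_def)
    show "Vector_Spaces.linear scale scale (\<lambda>x. scale \<delta> (b x))"
      by (rule linear_compose_scale_right[OF b])
    fix x assume "x \<in> set ?bs"
    then obtain n v w i where t: "(n, v, w) \<in> set ts"
      and x: "x = act ([:0, 1:] ^ i) v \<or> x = act ([:0, 1:] ^ i) w" using dest by blast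
    have "u (b (u (act f v))) = scale \<delta> (b (act f v)) \<and> u (b (u (act f w))) = scale \<delta> (b (act f w))" for f
    proof -
      have "u (act f y) = act ([:0, 1:] * f) y" for y by (simp add: act_mult del: mult_pCons_left)
      then show ?thesis
        using bvw[OF t, of f] bvw[OF t, of "[:0, 1:] * f"]
        by (simp add: conj_mult act_mult u_conj_X del: mult_pCons_left)
    qed
    with x show "u (b (u x)) = scale \<delta> (b x)" by blast
  qed
  ultimately show ?thesis using b by blast
qed

end

lemma monic_dvd_irreducible_power:
  fixes r f :: "'a::field poly"
  assumes irr: "Factorial_Ring.irreducible r" and r: "lead_coeff r = 1"
    and "f dvd r ^ n" "lead_coeff f = 1"
  shows "\<exists>k. f = r ^ k"
  using assms(3,4)
proof (induction n arbitrary: f)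
  case 0
  then have "is_unit f" by simp
  then obtain c where "f = [:c:]" by (rule is_unit_polyE)
  then have "f = r ^ 0" using 0(2) by (simp add: one_pCons)
  then show ?case ..
next
  case (Suc n)
  show ?case
  proof (cases "r dvd f")
    case True
    then obtain g where g: "f = r * g" by (rule dvdE)
    have "r \<noteq> 0" using r by auto
    then have "g dvd r ^ n" "lead_coeff g = 1"
      using Suc.prems r by (simp_all add: g lead_coeff_mult)
    then obtain k where "g = r ^ k" using Suc.IH by blast
    then have "f = r ^ Suc k" by (simp add: g)
    then show ?thesis ..
  next
    case False
    then obtain s where "r ^ Suc n dvd 1 - s * f"
      using irreducible_power_bezout[OF irr] by blast
    \<comment> \<open>Now \<open>f\<close> divides both \<open>1 - s f\<close> and
      \<open>s f\<close>, hence 1.\<close>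
    then have "f dvd 1 - s * f" using Suc.prems(1) dvd_trans by blast
    then have "f dvd 1 - s * f + s * f" by (rule dvd_add) simp
    then have "f dvd r ^ n" by (simp add: unit_imp_dvd)
    then show ?thesis using Suc.IH Suc.prems(2) by blast
  qed
qed

lemma map_upt_pairs:
  "map g [1..<2 * N + 1] = concat (map (\<lambda>k. [g (2 * k + 1), g (2 * k + 2)]) [0..<N])"
  by (induction N) simp_all

section \<open>Invariant factors\<close>

context endomorphism
begin

text \<open>Allows the triples to be sorted by exponent, as the divisibility chain of invariant
  factors demands.\<close>

lemma list_basis_paired_orbits_mset:
  assumes "mset ts = mset ts'" "list_basis scale S (paired_orbits r ts)"
  shows "list_basis scale S (paired_orbits r ts')"
proof -
  have "mset (paired_orbits r ts) = sum_mset (image_mset mset (image_mset (\<lambda>(n, v, w).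
     orbit u v (Polynomial.degree (r ^ n)) @ orbit u w (Polynomial.degree (r ^ n))) (mset ts)))" for ts
    unfolding paired_orbits_concat mset_concat by (simp flip: mset_map sum_mset_sum_list)
  then have "mset (paired_orbits r ts) = mset (paired_orbits r ts')"
    using assms(1) by simp
  then have "distinct (paired_orbits r ts) = distinct (paired_orbits r ts')"
    and "set (paired_orbits r ts) = set (paired_orbits r ts')"
    by (rule mset_eq_imp_distinct_iff, rule mset_eq_setD)
  then show ?thesis using assms(2) by (simp add: list_basis_def)
qed

lemma paired_orbits_dvd:
  assumes "r \<noteq> 0" and ts: "(n, v, w) \<in> set ts" "act (r ^ n) v = 0"
    and basis: "list_basis scale S (paired_orbits r ts)" and f: "act f v = 0"
  shows "r ^ n dvd f"
proof -
  let ?d = "Polynomial.degree (r ^ n)"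
  let ?xss = "concat (map (\<lambda>(n, v, w).
     [orbit u v (Polynomial.degree (r ^ n)), orbit u w (Polynomial.degree (r ^ n))]) ts)"
  have "paired_orbits r ts = concat ?xss"
    unfolding paired_orbits_concat by (induction ts) auto
  with basis have "list_basis scale S (concat ?xss)" by simp
  moreover have "orbit u v ?d \<in> set ?xss" using ts(1) by force
  ultimately have "list_basis scale (span (set (orbit u v ?d))) (orbit u v ?d)"
    by (rule list_basis_subset)
  then show ?thesis
    using orbit_annihilator_dvd[OF _ ts(2) _ f] assms(1) by simp
qed

lemma is_min_poly_paired_orbits:
  assumes r: "lead_coeff r = 1"
    and ts: "\<forall>(n, v, w)\<in>set ts. act (r ^ n) v = 0 \<and> act (r ^ n) w = 0"
    and basis: "list_basis scale UNIV (paired_orbits r ts)"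
  shows "\<exists>n. is_min_poly scale u (r ^ n)"
proof -
  have "r \<noteq> 0" using r by auto
  \<comment> \<open>The inserted 0 covers the zero space, whose minimal polynomial is
    \<open>r ^ 0 = 1\<close>.\<close>
  define m where "m = Max (insert 0 (fst ` set ts))"
  have le: "n \<le> m" if "(n, v, w) \<in> set ts" for n v w
    unfolding m_def using that by (intro Max_ge) force+
  have "act (r ^ m) x = 0" if x_mem: "x \<in> set (paired_orbits r ts)" for x
  proof -
    obtain n v w i where t: "(n, v, w) \<in> set ts" and x: "x = (u ^^ i) v \<or> x = (u ^^ i) w"
      using paired_orbits_mem[OF x_mem] by blast
    have "act (r ^ m) v = 0" "act (r ^ m) w = 0"
      using ts t le[OF t] by (auto intro: act_power_le)
    then have "act (r ^ m) (act ([:0, 1:] ^ i) v) = 0" "act (r ^ m) (act ([:0, 1:] ^ i) w) = 0"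
      by (simp_all add: act_commute[of "r ^ m"] linear_0[OF linear_act])
    then show ?thesis using x by (auto simp: act_X_power)
  qed
  then have "act (r ^ m) x = 0" for x
    using linear_eq_0_on_span[OF linear_act] basis unfolding list_basis_def by blast
  then have "annihilates scale (r ^ m) u" by (simp add: annihilates_def)
  moreover have "r ^ m dvd f" if f: "annihilates scale f u" for f
  proof (cases "m = 0")
    case False
    have "m \<in> insert 0 (fst ` set ts)"
      unfolding m_def by (rule Max_in) auto
    with False obtain v w where t: "(m, v, w) \<in> set ts" by force
    then have "act (r ^ m) v = 0" using ts by auto
    from paired_orbits_dvd[OF \<open>r \<noteq> 0\<close> t this basis] show ?thesis
      using f by (simp add: annihilates_def)
  qed simp
  ultimately show ?thesis
    using r unfolding is_min_poly_def by (auto simp: lead_coeff_power)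
qed

lemma paired_orbits_imp_invariant_factors:
  assumes r: "lead_coeff r = 1"
    and ts: "\<forall>(n, v, w)\<in>set ts. act (r ^ n) v = 0 \<and> act (r ^ n) w = 0"
    and basis: "list_basis scale UNIV (paired_orbits r ts)"
  shows "\<exists>rs. is_invariant_factors scale u rs \<and> (\<forall>k\<ge>1. rs (2 * k - 1) = rs (2 * k))"
proof -
  define ts' where "ts' = rev (sort_key fst ts)"
  define ns where "ns = map fst ts'"
  let ?L = "length ns"
  \<comment> \<open>With \<open>ns\<close> in decreasing order, positions \<open>2 k - 1\<close> and
    \<open>2 k\<close> both read entry \<open>k - 1\<close>; past the end the exponent is 0, which
    gives the factor 1.\<close>
  define e where "e i = (if (i - 1) div 2 < ?L then ns ! ((i - 1) div 2) else 0)" for i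
  define rs where "rs i = r ^ e i" for i
  have sorted: "sorted (rev ns)" by (simp add: ns_def ts'_def rev_map)
  have "e (i + 1) \<le> e i" if "i \<ge> 1" for i
  proof (cases "i div 2 < ?L")
    case True
    then have "(i - 1) div 2 < ?L" by linarith
    with True show ?thesis
      using sorted_rev_nth_mono[OF sorted, of "(i - 1) div 2" "i div 2"] by (simp add: e_def div_le_mono)
  qed (simp add: e_def)
  then have chain: "lead_coeff (rs i) = 1 \<and> rs (i + 1) dvd rs i" if "i \<ge> 1" for i
    using r that by (simp add: rs_def lead_coeff_power le_imp_power_dvd)
  have large: "rs i = 1" if "i > 2 * ?L" for i
    using that by (simp add: rs_def e_def)
  have pairs: "map rs [1..<2 * ?L + 1] = concat (map (\<lambda>n. [r ^ n, r ^ n]) ns)"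
  proof -
    have "map (\<lambda>k. [rs (2 * k + 1), rs (2 * k + 2)]) [0..<?L] = map (\<lambda>k. [r ^ (ns ! k), r ^ (ns ! k)]) [0..<?L]"
      by (rule map_cong) (auto simp: rs_def e_def)
    also have "\<dots> = map (\<lambda>n. [r ^ n, r ^ n]) ns"
      by (rule nth_equalityI) auto
    finally show ?thesis unfolding map_upt_pairs by simp
  qed
  have "list_basis scale UNIV (paired_orbits r ts')"
    by (rule list_basis_paired_orbits_mset[OF _ basis]) (simp add: ts'_def)
  moreover have "\<forall>(n, v, w)\<in>set ts'. act (r ^ n) v = 0 \<and> act (r ^ n) w = 0"
    using ts by (simp add: ts'_def)
  then have "\<exists>ps. map fst ps = concat (map (\<lambda>n. [r ^ n, r ^ n]) ns) \<and>
      paired_orbits r ts' = orbits ps \<and> (\<forall>(f, v)\<in>set ps. act f v = 0)"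
    unfolding ex_paired_iff using ns_def by blast
  moreover have "\<forall>f\<in>set (map rs [1..<2 * ?L + 1]). lead_coeff f = 1"
    using chain by auto
  note acts_by_diag_companion_mat_iff[OF this]
  ultimately have "represented_by scale u (paired_orbits r ts')
      (diag_block_mat (map companion_mat (map rs [1..<2 * ?L + 1])))"
    unfolding represented_by_iff ordered_basis_iff pairs by simp
  then have "is_invariant_factors scale u rs"
    unfolding is_invariant_factors_def using chain large
    by (intro conjI exI[of _ "2 * ?L"] exI[of _ "paired_orbits r ts'"]) (simp_all add: o_def)
  moreover have "rs (2 * k - 1) = rs (2 * k)" if "k \<ge> 1" for k
  proof -
    have "(2 * k - 1 - 1) div 2 = (2 * k - 1) div 2" using that by (cases k) auto
    then show ?thesis by (simp add: rs_def e_def)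
  qed
  ultimately show ?thesis by blast
qed

text \<open>Each nontrivial invariant factor is the annihilator of a basis generator, so it divides
  \<open>r ^ n\<close> and is a power of \<open>r\<close>; equal neighbours then form the
  pairs.\<close>

lemma invariant_factors_imp_paired_orbits:
  assumes irr: "Factorial_Ring.irreducible r" and r: "lead_coeff r = 1"
    and ann: "annihilates scale (r ^ n) u"
    and rs: "is_invariant_factors scale u rs" and pairs: "\<forall>k\<ge>1. rs (2 * k - 1) = rs (2 * k)"
  shows "\<exists>ts. (\<forall>(n, v, w)\<in>set ts. 0 < n \<and> act (r ^ n) v = 0 \<and> act (r ^ n) w = 0) \<and>
              list_basis scale UNIV (paired_orbits r ts)"
proof -
  obtain N bs where large: "\<forall>i>N. rs i = 1"
    and rep: "represented_by scale u bs (diag_block_mat (map (\<lambda>i. companion_mat (rs i)) [1..<N + 1]))"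
    using rs unfolding is_invariant_factors_def by blast
  have monic: "lead_coeff (rs i) = 1" if "i \<ge> 1" for i
    using rs that unfolding is_invariant_factors_def by blast
  have "represented_by scale u bs (diag_block_mat (map companion_mat (map rs [1..<N + 1])))"
    using rep by (simp add: o_def)
  moreover have "\<forall>f\<in>set (map rs [1..<N + 1]). lead_coeff f = 1"
    using monic by auto
  ultimately obtain ps where ps: "map fst ps = map rs [1..<N + 1]" "bs = orbits ps"
      "\<forall>(f, v)\<in>set ps. act f v = 0" and basis: "list_basis scale UNIV bs"
    unfolding represented_by_iff ordered_basis_iff
    using acts_by_diag_companion_mat_iff by blast
  have "\<exists>k. rs i = r ^ k" if i: "i \<ge> 1" for i
  proof (cases "i \<le> N")
    case True
    then have "rs i \<in> fst ` set ps"
      using i by (metis ps(1) set_map imageI atLeastLessThan_iff set_upt less_Suc_eq_le Suc_eq_plus1)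
    then obtain v where v: "(rs i, v) \<in> set ps" by force
    then have ann_v: "act (rs i) v = 0" using ps(3) by auto
    let ?o = "orbit u v (Polynomial.degree (rs i))"
    have "?o \<in> set (map (\<lambda>(f, v). orbit u v (Polynomial.degree f)) ps)"
      using v by force
    with basis have "list_basis scale (span (set ?o)) ?o"
      unfolding ps(2) by (rule list_basis_subset)
    moreover have "rs i \<noteq> 0" using monic[OF i] by auto
    ultimately have "rs i dvd r ^ n"
      using orbit_annihilator_dvd[OF _ ann_v] ann by (simp add: annihilates_def)
    then show ?thesis by (rule monic_dvd_irreducible_power[OF irr r _ monic[OF i]])
  next
    case False
    then show ?thesis using large by (intro exI[of _ 0]) simp
  qed
  then obtain e where e: "\<And>i. i \<ge> 1 \<Longrightarrow> rs i = r ^ e i" by metis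
  \<comment> \<open>\<open>N\<close> may be odd, so \<open>N\<close> trivial blocks with empty
    orbits pad the list to the even length \<open>2 N\<close>. Triples of exponent 0 are filtered
    out at the end.\<close>
  let ?qs = "ps @ replicate N (1, 0)" and ?ns = "map (\<lambda>k. e (2 * k + 1)) [0..<N]"
  have "map rs [N + 1..<2 * N + 1] = replicate N 1"
    by (rule replicate_eqI) (use large in auto)
  moreover have "[1..<2 * N + 1] = [1..<N + 1] @ [N + 1..<2 * N + 1]"
    using upt_add_eq_append[of 1 "N + 1" N] by (simp add: mult_2)
  ultimately have "map fst ?qs = map rs [1..<2 * N + 1]"
    using ps(1) by simp
  also have "\<dots> = concat (map (\<lambda>k. [rs (2 * k + 1), rs (2 * k + 2)]) [0..<N])"
    by (rule map_upt_pairs)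
  also have "map (\<lambda>k. [rs (2 * k + 1), rs (2 * k + 2)]) [0..<N] = map (\<lambda>n. [r ^ n, r ^ n]) ?ns"
  proof -
    have "rs (2 * k + 1) = r ^ e (2 * k + 1) \<and> rs (2 * k + 2) = r ^ e (2 * k + 1)" for k
      using pairs[rule_format, of "k + 1"] e[of "2 * k + 1"] by simp
    then show ?thesis by simp
  qed
  finally have fst_qs: "map fst ?qs = concat (map (\<lambda>n. [r ^ n, r ^ n]) ?ns)" .
  have qs: "bs = orbits ?qs" "\<forall>(f, v)\<in>set ?qs. act f v = 0"
    using ps(2,3) by (auto simp: orbit_def)
  have "\<exists>ps. map fst ps = concat (map (\<lambda>n. [r ^ n, r ^ n]) ?ns) \<and> bs = orbits ps \<and>
      (\<forall>(f, v)\<in>set ps. act f v = 0)"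
    by (intro exI[of _ ?qs] conjI fst_qs qs)
  then obtain ts where ts: "bs = paired_orbits r ts"
      "\<forall>(n, v, w)\<in>set ts. act (r ^ n) v = 0 \<and> act (r ^ n) w = 0"
    unfolding ex_paired_iff by blast
  let ?ts = "filter (\<lambda>t. 0 < fst t) ts"
  have "paired_orbits r ?ts = paired_orbits r ts"
    by (induction ts) (auto simp: paired_orbits_def orbit_def)
  then show ?thesis
    using ts basis by (intro exI[of _ ?ts]) auto
qed

end

section \<open>Quadratic polynomials and \<open>(p, q)\<close>-quotients\<close>

lemma irreducible_X2_minus:
  fixes c :: "'a::field"
  assumes "\<And>z. c \<noteq> z\<^sup>2"
  shows "Factorial_Ring.irreducible [:- c, 0, 1:]"
proof (rule irreducibleI)
  fix f g assume fg: "[:- c, 0, 1:] = f * g"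
  show "is_unit f \<or> is_unit g"
  proof (rule ccontr)
    assume units: "\<not> (is_unit f \<or> is_unit g)"
    have "f \<noteq> 0" "g \<noteq> 0" using fg by auto
    with units have "Polynomial.degree f \<noteq> 0" "Polynomial.degree g \<noteq> 0"
      by (simp_all add: is_unit_iff_degree)
    moreover have "Polynomial.degree f + Polynomial.degree g = 2"
      using degree_mult_eq[OF \<open>f \<noteq> 0\<close> \<open>g \<noteq> 0\<close>] by (simp flip: fg)
    ultimately have "Polynomial.degree f = 1" by linarith
    then obtain a b where f: "f = [:a, b:]" "b \<noteq> 0" by (rule degree1_coeffs)
    have "poly f (- a / b) = 0" using f by simp
    then have "poly [:- c, 0, 1:] (- a / b) = 0" unfolding fg by simp
    then have "c = (- a / b)\<^sup>2" by (simp add: power2_eq_square)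
    with assms show False by blast
  qed
qed (simp_all add: is_unit_iff_degree)

lemma irreducible_X2_minus_imp_not_square:
  fixes c :: "'a::field"
  assumes "Factorial_Ring.irreducible [:- c, 0, 1:]"
  shows "c \<noteq> z\<^sup>2"
proof
  assume "c = z\<^sup>2"
  then have "[:- c, 0, 1:] = [:- z, 1:] * [:z, 1:]" by (simp add: power2_eq_square)
  from irreducibleD[OF assms this] show False by (simp add: is_unit_iff_degree)
qed

text \<open>The form \<open>x\<^sup>2 - Q y\<^sup>2\<close> is anisotropic over the field of polynomials modulo \<open>X\<^sup>2 - \<delta>\<close>,
  because \<open>Q\<close> has no square root there.\<close>

lemma norm_form_anisotropic:
  fixes Q \<delta> :: "'a::field"
  assumes two: "(2::'a) \<noteq> 0" and r: "r = [:- \<delta>, 0, 1:]" and irr: "Factorial_Ring.irreducible r"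
    and Q: "\<And>z. Q \<noteq> z\<^sup>2" and \<delta>Q: "\<And>z. \<delta> * Q \<noteq> z\<^sup>2"
    and dvd: "r dvd f\<^sup>2 - smult Q (g\<^sup>2)"
  shows "r dvd f \<and> r dvd g"
proof -
  have "r \<noteq> 0" "Polynomial.degree r = 2" by (simp_all add: r)
  have prime: "prime_elem r" by (rule field_poly_irreducible_imp_prime[OF irr])
  have g: "r dvd g"
  proof (rule ccontr)
    assume "\<not> r dvd g"
    then obtain k t where "k * g + t * r = 1"
      using irreducible_poly_bezout[OF irr] by blast
    then have kg: "1 - k * g = t * r" by (metis add_diff_cancel_left')
    \<comment> \<open>\<open>k\<close> inverts \<open>g\<close> modulo \<open>r\<close>, so
      \<open>h\<close> is the reduced representative of \<open>f / g\<close>, a square root of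
      \<open>Q\<close> in the residue field.\<close>
    define h where "h = (k * f) mod r"
    have "r dvd k\<^sup>2 * (f\<^sup>2 - smult Q (g\<^sup>2))" using dvd by (rule dvd_mult)
    moreover have "r dvd smult Q ((1 - k * g) * (1 + k * g))"
      unfolding kg by (intro dvd_smult) simp
    moreover have "r dvd (k * f - h) * (k * f + h)"
      unfolding h_def using dvd_minus_mod by (rule dvd_mult2)
    ultimately have "r dvd k\<^sup>2 * (f\<^sup>2 - smult Q (g\<^sup>2)) - smult Q ((1 - k * g) * (1 + k * g))
        - (k * f - h) * (k * f + h)"
      by (intro dvd_diff)
    also have "\<dots> = h\<^sup>2 - [:Q:]"
      by (simp add: power2_eq_square algebra_simps smult_add_right smult_diff_right one_pCons)
    finally have h: "r dvd h\<^sup>2 - [:Q:]" .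
    have "Polynomial.degree h < 2"
      unfolding h_def using degree_mod_less[OF \<open>r \<noteq> 0\<close>, of "k * f"] \<open>Polynomial.degree r = 2\<close>
      by auto
    then have "h = [:Polynomial.coeff h 0, Polynomial.coeff h 1:]"
      by (intro poly_eqI) (auto simp: coeff_pCons coeff_eq_0 split: nat.split)
    then obtain x y where xy: "h = [:x, y:]" by blast
    \<comment> \<open>Subtracting \<open>y^2 r\<close> replaces \<open>X^2\<close> by \<delta> and
      leaves degree below 2, so divisibility by \<open>r\<close> forces the result to
      vanish.\<close>
    have "r dvd (h\<^sup>2 - [:Q:]) - smult (y\<^sup>2) r"
      by (rule dvd_diff[OF h dvd_smult[OF dvd_refl]])
    also have "(h\<^sup>2 - [:Q:]) - smult (y\<^sup>2) r = [:x\<^sup>2 + \<delta> * y\<^sup>2 - Q, 2 * x * y:]"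
      by (simp add: xy r power2_eq_square algebra_simps)
    finally have "[:x\<^sup>2 + \<delta> * y\<^sup>2 - Q, 2 * x * y:] = 0"
      using dvd_imp_degree_le[of r "[:x\<^sup>2 + \<delta> * y\<^sup>2 - Q, 2 * x * y:]"] \<open>Polynomial.degree r = 2\<close>
      by (cases "2 * x * y = 0") auto
    then have Qxy: "Q = x\<^sup>2 + \<delta> * y\<^sup>2" and "x = 0 \<or> y = 0"
      using two by auto
    then show False
    proof (elim disjE)
      assume "x = 0"
      then have "\<delta> * Q = (\<delta> * y)\<^sup>2" using Qxy by (simp add: power2_eq_square)
      with \<delta>Q show False by blast
    next
      assume "y = 0"
      then have "Q = x\<^sup>2" using Qxy by simp
      with Q show False by blast
    qed
  qed
  then have "r dvd smult Q (g\<^sup>2)" by (simp add: power2_eq_square dvd_smult)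
  then have "r dvd (f\<^sup>2 - smult Q (g\<^sup>2)) + smult Q (g\<^sup>2)" by (rule dvd_add[OF dvd])
  then have "r dvd f" using prime by (simp add: prime_elem_dvd_power_iff)
  with g show ?thesis by blast
qed

lemma monic_quadratic_trace_zero:
  assumes "lead_coeff f = 1" "Polynomial.degree f = 2" "poly_tr f = 0"
  shows "f = [:poly f 0, 0, 1:]"
proof (rule poly_eqI)
  fix i
  show "Polynomial.coeff f i = Polynomial.coeff [:poly f 0, 0, 1:] i"
  proof (cases "i \<le> 2")
    case True
    then have "i = 0 \<or> i = 1 \<or> i = 2" by auto
    then show ?thesis
      using assms by (auto simp: poly_0_coeff_0 poly_tr_def numeral_2_eq_2)
  next
    case False
    then show ?thesis
      using assms by (simp add: coeff_eq_0)
  qed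
qed

section \<open>Roots, separability and splitting fields of \<open>X^2 - c\<close>\<close>

lemma Root_X2_minus: "Root [:- c, 0, 1:] = {x. x\<^sup>2 = to_ac c}"
  by (auto simp: Root_def map_poly_pCons power2_eq_square)

lemma Root_X2_minus_nonempty: "\<exists>x. x \<in> Root [:- c, 0, 1:]"
  unfolding Root_def
  using alg_closed_imp_poly_has_root[of "map_poly to_ac [:- c, 0, 1:]"]
  by (simp add: map_poly_pCons)

text \<open>In characteristic 2, \<open>X^2 - c\<close> is the square of \<open>X - y\<close> for a
  root \<open>y\<close>, so it has a double root.\<close>

lemma separable_X2_minus_imp_two_nonzero:
  fixes c :: "'a::field"
  assumes "separable_poly [:- c, 0, 1:]"
  shows "(2::'a) \<noteq> 0"
proof
  assume "(2::'a) = 0"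
  then have "to_ac (2::'a) = 0" by simp
  then have two: "(2::'a alg_closure) = 0" by simp
  obtain y where "y\<^sup>2 = to_ac c"
    using Root_X2_minus_nonempty[of c] unfolding Root_X2_minus by blast
  let ?f = "map_poly to_ac [:- c, 0, 1:]"
  have "- (2 * y) = 0" using two by simp
  then have "[:- y, 1:] ^ 2 = [:y\<^sup>2, 0, 1:]"
    by (simp add: power2_eq_square flip: mult_2)
  moreover have "- to_ac c = to_ac c"
  proof -
    have "to_ac c + to_ac c = 2 * to_ac c" by simp
    also have "\<dots> = 0" using two by simp
    finally show ?thesis by (simp add: minus_equation_iff eq_neg_iff_add_eq_0)
  qed
  ultimately have "?f = [:- y, 1:] ^ 2"
    using \<open>y\<^sup>2 = to_ac c\<close> by (simp add: map_poly_pCons)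
  moreover have "?f \<noteq> 0" by (simp add: map_poly_pCons)
  ultimately have "2 \<le> order y ?f"
    by (metis dvd_refl order_divides)
  then show False
    using assms unfolding separable_poly_def rsquarefree_def by (metis not_numeral_le_zero numeral_le_one_iff semiring_norm(69))
qed

lemma generate_field_subset:
  assumes "H \<subseteq> generate_field R H'"
  shows "generate_field R H \<subseteq> generate_field R H'"
proof
  fix x assume "x \<in> generate_field R H"
  then show "x \<in> generate_field R H'"
    by induction (use assms in \<open>auto intro: generate_field.intros\<close>)
qed

text \<open>A root of \<open>X^2 - z^2 c\<close> is \<open>z\<close> times a root of
  \<open>X^2 - c\<close>.\<close>

lemma splitting_field_square_subset:
  assumes "z \<noteq> 0"
  shows "splitting_field [:- (z\<^sup>2 * c), 0, 1:] \<subseteq> splitting_field [:- c, 0, 1:]"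
proof -
  let ?R = "ring_of_type_algebra :: 'a alg_closure ring"
  let ?H = "range to_ac \<union> Root [:- c, 0, 1:]"
  have "x \<in> generate_field ?R ?H" if "x\<^sup>2 = to_ac (z\<^sup>2 * c)" for x
  proof -
    have "(x / to_ac z)\<^sup>2 = to_ac c"
      using that assms by (simp add: power_divide)
    then have "x / to_ac z \<in> generate_field ?R ?H"
      by (intro generate_field.incl) (simp add: Root_X2_minus)
    moreover have "to_ac z \<in> generate_field ?R ?H"
      by (intro generate_field.incl) simp
    ultimately have "to_ac z \<otimes>\<^bsub>?R\<^esub> (x / to_ac z) \<in> generate_field ?R ?H"
      by (rule generate_field.eng_mult[rotated])
    then show ?thesis using assms by (simp add: ring_of_type_algebra_def)
  qed
  then show ?thesis
    unfolding splitting_field_def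
    by (intro generate_field_subset) (auto simp: Root_X2_minus intro: generate_field.incl)
qed

lemma splitting_field_eq_if_square:
  assumes "z \<noteq> 0"
  shows "splitting_field [:- (z\<^sup>2 * c), 0, 1:] = splitting_field [:- c, 0, 1:]"
proof (rule equalityI)
  have "splitting_field [:- ((inverse z)\<^sup>2 * (z\<^sup>2 * c)), 0, 1:] \<subseteq> splitting_field [:- (z\<^sup>2 * c), 0, 1:]"
    by (rule splitting_field_square_subset) (use assms in simp)
  also have "(inverse z)\<^sup>2 * (z\<^sup>2 * c) = c"
    using assms by (simp add: field_simps)
  finally show "splitting_field [:- c, 0, 1:] \<subseteq> splitting_field [:- (z\<^sup>2 * c), 0, 1:]" .
qed (rule splitting_field_square_subset[OF assms])

section \<open>Quotients expressed through the single map \<open>b\<close>\<close>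

lemma annihilates_X2_minus_iff:
  assumes "Vector_Spaces.linear scale scale a"
  shows "annihilates scale [:- c, 0, 1:] a \<longleftrightarrow> (\<forall>x. a (a x) = scale c x)"
proof -
  interpret a: endomorphism scale a
    using assms by (simp add: endomorphism_def endomorphism_axioms_def Vector_Spaces.linear_def)
  have "a.act [:- c, 0, 1:] x = a (a x) - scale c x" for x
    by (simp add: a.act_pCons a.linear_0[OF assms])
  then show ?thesis by (simp add: annihilates_def)
qed

context endomorphism
begin

text \<open>With \<open>a = u b\<close> and \<open>b^2 = Q\<close>, the condition
  \<open>a^2 = P\<close> becomes \<open>u b u = (P / Q) b\<close>. Both maps are bijective because
  their squares are nonzero scalars.\<close>

lemma pq_quotient_iff:
  assumes P: "P \<noteq> 0" and Q: "Q \<noteq> 0"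
  shows "pq_quotient scale [:- P, 0, 1:] [:- Q, 0, 1:] u \<longleftrightarrow>
    (\<exists>b. Vector_Spaces.linear scale scale b \<and> (\<forall>x. b (b x) = scale Q x) \<and>
         (\<forall>x. u (b (u x)) = scale (P / Q) (b x)))" (is "?L \<longleftrightarrow> ?R")
proof
  assume ?L
  then obtain a b where a: "Vector_Spaces.linear scale scale a" "annihilates scale [:- P, 0, 1:] a"
    and b: "Vector_Spaces.linear scale scale b" "bij b" "annihilates scale [:- Q, 0, 1:] b"
    and u: "u = a \<circ> inv_into UNIV b"
    unfolding pq_quotient_def automorphism_def by blast
  have aa: "a (a x) = scale P x" and bb: "b (b x) = scale Q x" for x
    using a b by (simp_all add: annihilates_X2_minus_iff)
  have ub: "u (b x) = a x" for x
    using b(2) by (simp add: u bij_is_inj)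
  have "u (b (u x)) = scale (P / Q) (b x)" for x
  proof -
    obtain y where y: "x = b y" using b(2) by (metis bij_pointE)
    have "u (b (u x)) = scale P y" by (simp add: ub y aa)
    then show ?thesis using Q by (simp add: y bb)
  qed
  with b(1) bb show ?R by blast
next
  assume ?R
  then obtain b where b: "Vector_Spaces.linear scale scale b" and bb: "\<And>x. b (b x) = scale Q x"
    and ubu: "\<And>x. u (b (u x)) = scale (P / Q) (b x)" by blast
  have bij: "bij f" if f: "Vector_Spaces.linear scale scale f" "\<And>x. f (f x) = scale c x" "c \<noteq> 0" for f c
  proof (rule bijI)
    show "inj f" using f(2,3) by (metis injI scale_cancel_left)
    show "surj f"
      by (rule surjI[of f "\<lambda>x. scale (inverse c) (f x)"])
        (use f in \<open>simp add: linear_scale[OF f(1)]\<close>)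
  qed
  let ?a = "u \<circ> b"
  have a: "Vector_Spaces.linear scale scale ?a"
    by (rule Vector_Spaces.linear_compose[OF b linear_u])
  have aa: "?a (?a x) = scale P x" for x
    using Q by (simp add: ubu bb)
  have "bij b" by (rule bij[OF b bb Q])
  moreover have "bij ?a" by (rule bij[OF a aa P])
  moreover have "u = ?a \<circ> inv_into UNIV b"
    using \<open>bij b\<close> by (simp add: fun_eq_iff bij_is_surj surj_f_inv_f)
  ultimately show ?L
    unfolding pq_quotient_def automorphism_def
    using a b annihilates_X2_minus_iff[OF a] annihilates_X2_minus_iff[OF b] aa bb by blast
qed

end

theorem theorem4p34:
  fixes scale :: "'a::field \<Rightarrow> 'v::ab_group_add \<Rightarrow> 'v"
    and Basis :: "'v set"
    and p q r :: "'a poly"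
    and u :: "'v \<Rightarrow> 'v"
  assumes "lead_coeff p = 1" and "Polynomial.degree p = 2"
    and "lead_coeff q = 1" and "Polynomial.degree q = 2"
    and "Factorial_Ring.irreducible p" and "Factorial_Ring.irreducible q"
    and "splitting_field p \<noteq> splitting_field q"
    and "separable_poly p" and "separable_poly q"
    and "poly_tr p = 0" and "poly_tr q = 0"
    and "r = Polynomial.monom 1 2 - [:poly p 0 * inverse (poly q 0):]"
    and "finite_dimensional_vector_space scale Basis"
    and "Vector_Spaces.linear scale scale u"
  shows "(pq_quotient scale p q u \<and> q_exceptional scale p q u
          \<longleftrightarrow>
          (\<exists>n. is_min_poly scale u (r ^ n)) \<and>
          (\<exists>rs. is_invariant_factors scale u rs \<and> (\<forall>k\<ge>1. rs (2 * k - 1) = rs (2 * k))))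
       \<and> ((\<exists>n. is_min_poly scale u (r ^ n)) \<and>
          (\<exists>rs. is_invariant_factors scale u rs \<and> (\<forall>k\<ge>1. rs (2 * k - 1) = rs (2 * k)))
          \<longleftrightarrow>
          (\<exists>bs ns. (\<forall>n\<in>set ns. 0 < n) \<and>
             represented_by scale u bs
               (diag_block_mat
                 (map (\<lambda>n. diag_block_mat [companion_mat (r ^ n), companion_mat (r ^ n)]) ns))))"
    (is "(?i \<longleftrightarrow> ?ii) \<and> (?ii \<longleftrightarrow> ?iii)")
proof -
  define P where "P = - poly p 0"
  define Q where "Q = - poly q 0"
  define \<delta> where "\<delta> = P / Q"
  have p: "p = [:- P, 0, 1:]"
    using monic_quadratic_trace_zero[of p] assms by (simp add: P_def)
  have q: "q = [:- Q, 0, 1:]"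
    using monic_quadratic_trace_zero[of q] assms by (simp add: Q_def)
  have P: "P \<noteq> z\<^sup>2" for z
    using irreducible_X2_minus_imp_not_square assms(5) p by blast
  have Q: "Q \<noteq> z\<^sup>2" for z
    using irreducible_X2_minus_imp_not_square assms(6) q by blast
  have P0: "P \<noteq> 0" and Q0: "Q \<noteq> 0" using P[of 0] Q[of 0] by simp_all
  have two: "(2::'a) \<noteq> 0"
    using separable_X2_minus_imp_two_nonzero assms(8) p by blast
  have r: "r = [:- \<delta>, 0, 1:]"
    unfolding assms(12) \<delta>_def P_def Q_def
    by (simp add: monom_altdef power2_eq_square divide_inverse)
  \<comment> \<open>If \<delta> were a square, \<open>P\<close> and \<open>Q\<close> would differ by
    a square factor and the splitting fields would coincide.\<close>
  have \<delta>: "\<delta> \<noteq> z\<^sup>2" for z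
  proof
    assume "\<delta> = z\<^sup>2"
    then have "P = z\<^sup>2 * Q" "z \<noteq> 0" using Q0 P0 by (auto simp: \<delta>_def field_simps)
    then have "splitting_field p = splitting_field q"
      unfolding p q using splitting_field_eq_if_square[of z Q] by simp
    with assms(7) show False ..
  qed
  have irr: "Factorial_Ring.irreducible r"
    unfolding r by (rule irreducible_X2_minus[OF \<delta>])
  have monic: "lead_coeff r = 1" by (simp add: r)
  \<comment> \<open>The product is \<open>P\<close>, which is not a square since \<open>p\<close> is
    irreducible.\<close>
  have "\<delta> * Q \<noteq> z\<^sup>2" for z using P Q0 by (simp add: \<delta>_def)
  note aniso = norm_form_anisotropic[OF two r irr Q this]
  have quotient_root: "x * inverse y \<in> {z. z\<^sup>2 = to_ac \<delta>}" if "x \<in> Root p" "y \<in> Root q" for x y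
    using that unfolding p q Root_X2_minus by (simp add: \<delta>_def power_mult_distrib power_inverse divide_inverse)
  interpret V: finite_dimensional_vector_space scale Basis by (rule assms(13))
  interpret E: endomorphism scale u
    by (intro endomorphism.intro endomorphism_axioms.intro V.vector_space_axioms assms(14))
  \<comment> \<open>All three conditions are compared with the existence of a basis made of paired
    orbits.\<close>
  let ?T = "\<exists>ts. (\<forall>(n, v, w)\<in>set ts. 0 < n \<and> E.act (r ^ n) v = 0 \<and> E.act (r ^ n) w = 0) \<and>
              list_basis scale UNIV (E.paired_orbits r ts)"
  have iii: "?iii \<longleftrightarrow> ?T"
    by (rule E.represented_by_paired_blocks_iff[OF monic])
  have ii_imp: "?T" if ?ii
    using that E.invariant_factors_imp_paired_orbits[OF irr monic] unfolding is_min_poly_def by blast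
  have imp_ii: "?ii" if ?T
  proof -
    from that obtain ts where ts: "\<forall>(n, v, w)\<in>set ts. E.act (r ^ n) v = 0 \<and> E.act (r ^ n) w = 0"
      and basis: "list_basis scale UNIV (E.paired_orbits r ts)"
      by fast
    show ?ii
      using E.is_min_poly_paired_orbits[OF monic ts basis]
        E.paired_orbits_imp_invariant_factors[OF monic ts basis] by blast
  qed
  have i_imp: "?T" if i: ?i
  proof -
    obtain bs A where rep: "represented_by scale u bs A"
      using E.ex_represented_by[OF V.finite_Basis V.span_Basis V.independent_Basis] by blast
    then have A: "A \<in> carrier_mat (length bs) (length bs)" by (simp add: represented_by_def)
    interpret to_ac: comm_ring_hom "to_ac :: 'a \<Rightarrow> 'a alg_closure"
      by unfold_locales simp_all
    \<comment> \<open>Exceptionality enters here: a root of the characteristic polynomial is some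
      \<open>x / y\<close> with \<open>x^2 = P\<close> and \<open>y^2 = Q\<close>, so its square is
      \<delta>. This makes \<open>r(u)\<close> nilpotent.\<close>
    have "poly (map_poly to_ac r) z = 0" if z: "poly (map_poly to_ac (char_poly A)) z = 0" for z
    proof -
      have "eigenvalue (map_mat to_ac A) z"
        using z A by (simp add: eigenvalue_root_char_poly[of _ "length bs"] to_ac.char_poly_hom[OF A])
      then have "closure_eigenvalue scale u z"
        unfolding closure_eigenvalue_def using rep by (intro exI conjI)
      then have "z \<in> {x * inverse y | x y. x \<in> Root p \<and> y \<in> Root q}"
        using i[THEN conjunct2] unfolding q_exceptional_def by simp
      then obtain x y where xy: "x \<in> Root p" "y \<in> Root q" "z = x * inverse y"
        by (elim CollectE exE conjE)
      have "z\<^sup>2 = to_ac \<delta>" using quotient_root[OF xy(1,2)] xy(3) by simp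
      then show ?thesis by (simp add: r map_poly_pCons power2_eq_square)
    qed
    moreover have "char_poly A \<noteq> 0"
      using degree_monic_char_poly[OF A] by auto
    ultimately obtain N where "char_poly A dvd r ^ N"
      using dvd_irreducible_power_if_roots[OF irr] by blast
    then have N: "E.act (r ^ N) v = 0" for v
      using E.char_poly_annihilates[OF rep] E.act_dvd unfolding annihilates_def by blast
    obtain b where b: "Vector_Spaces.linear scale scale b" "\<And>x. b (b x) = scale Q x"
        "\<And>x. u (b (u x)) = scale \<delta> (b x)"
      using i E.pq_quotient_iff[OF P0 Q0] unfolding p q \<delta>_def by blast
    interpret twisted_pair scale u \<delta> r N Basis b Q
      by (intro twisted_pair.intro primary_endomorphism.intro primary_endomorphism_axioms.intro
          twisted_pair_axioms.intro E.endomorphism_axioms V.finite_dimensional_vector_space_axioms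
          r irr N b aniso)
    have "stable UNIV" by (simp add: stable_def)
    then show ?T by (rule stable_decomposition)
  qed
  have imp_i: "?i" if ?T
  proof
    from that obtain ts where ts: "\<forall>(n, v, w)\<in>set ts. E.act (r ^ n) v = 0 \<and> E.act (r ^ n) w = 0"
      and basis: "list_basis scale UNIV (E.paired_orbits r ts)"
      by fast
    obtain N where N: "annihilates scale (r ^ N) u"
      using E.is_min_poly_paired_orbits[OF monic ts basis] unfolding is_min_poly_def by blast
    interpret primary_endomorphism scale u \<delta> r N
      by unfold_locales (use r irr N in \<open>auto simp: annihilates_def\<close>)
    show "pq_quotient scale p q u"
      unfolding p q E.pq_quotient_iff[OF P0 Q0] using ex_twisting_map[OF ts basis, of Q]
      by (simp add: \<delta>_def)
    show "q_exceptional scale p q u"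
      unfolding q_exceptional_def
    proof (intro allI impI)
      fix z assume "closure_eigenvalue scale u z"
      then have "poly (map_poly to_ac (r ^ N)) z = 0"
        unfolding closure_eigenvalue_def using E.eigenvalue_root_of_annihilator[OF N] by blast
      interpret to_ac: map_poly_inj_comm_ring_hom "to_ac :: 'a \<Rightarrow> 'a alg_closure"
        by unfold_locales simp_all
      have "poly (map_poly to_ac r) z = 0"
        using \<open>poly (map_poly to_ac (r ^ N)) z = 0\<close> by (simp add: to_ac.hom_power poly_power)
      then have z: "z\<^sup>2 = to_ac \<delta>"
        by (simp add: r map_poly_pCons power2_eq_square)
      \<comment> \<open>Any root \<open>y\<close> of \<open>q\<close> works:
        \<open>(z y)^2 = \<delta> Q = P\<close> makes \<open>z y\<close> a root of \<open>p\<close>,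
        and \<open>z\<close> is the quotient of the two.\<close>
      obtain y where y: "y \<in> Root q" using Root_X2_minus_nonempty q by blast
      then have "y\<^sup>2 = to_ac Q" by (simp add: q Root_X2_minus)
      then have "(z * y)\<^sup>2 = to_ac P" "y \<noteq> 0"
        using z Q0 by (auto simp: power_mult_distrib \<delta>_def)
      then have "z * y \<in> Root p" "z = (z * y) * inverse y"
        by (simp_all add: p Root_X2_minus)
      with y show "z \<in> {x * inverse y | x y. x \<in> Root p \<and> y \<in> Root q}" by blast
    qed
  qed
  show ?thesis using iii ii_imp imp_ii i_imp imp_i by blast
qed

end
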